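(* Let $w=(w_1,\dots,w_N)\in\{\prec,\succ,\prec',\succ'\}^N$ be a word and let $Z=(z_1,\dots,z_N)$ be nonnegative real parameters such that $z_iz_j<1$ whenever $i<j$ and $(w_i,w_j)\in\{(\prec,\succ),(\prec',\succ')\}$. Then the output $\Lambda$ of the randomized algorithm SchurSample run on $(w,Z)$ (described in the context) is distributed exactly according to the Schur process of word $w$ with parameters $Z$. This remains true if the double loop over the boxes in the algorithm is replaced by any loop that visits every box $(i,j)$ of the encoded shape $\pi=sh(w)$ exactly once and respects their partial order, i.e. such that for distinct boxes $(i_1,j_1)\neq(i_2,j_2)$ with $i_2\ge i_1$ and $j_2\ge j_1$, the partition $\tau(i_1,j_1)$ is sampled before $\tau(i_2,j_2)$.
   Context: **Partitions.** A partition $\lambda$ is a nonincreasing, eventually zero sequence $\lambda_1\ge\lambda_2\ge\cdots$ of nonnegative integers; $\ell(\lambda)$ is its number of positive parts, $|\lambda|=\sum_i\lambda_i$, $\emptyset$ is the zero partition, $\lambda'$ is the conjugate partition, $\lambda'_i=|\{j:\lambda_j\ge i\}|$. Write $\lambda\succ\mu$ (equivalently $\mu\prec\lambda$) if $\lambda_1\ge\mu_1\ge\lambda_2\ge\mu_2\ge\cdots$, and $\lambda\succ'\mu$ (equivalently $\mu\prec'\lambda$) if $\lambda'\succ\mu'$, i.e. $0\le\lambda_i-\mu_i\le1$ for all $i$. **Schur process.** A sequence of partitions $\Lambda=(\emptyset=\lambda(0),\lambda(1),\dots,\lambda(N)=\emptyset)$ is $w$-interlaced if $\lambda(i-1)\,w_i\,\lambda(i)$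 for $i=1,\dots,N$. The Schur process of word $w$ with parameters $Z$ is the probability measure on $w$-interlaced sequences with $Prob(\Lambda)\propto\prod_{i=1}^N z_i^{||\lambda(i)|-|\lambda(i-1)||}$ (with $0^0=1$). **Random variables.** $Geom(\xi)$, $0\le\xi<1$: $Prob(k)=(1-\xi)\xi^k$, $k=0,1,2,\dots$. $Bernoulli(p)$: value $1$ with probability $p$, value $0$ with probability $1-p$. All random draws in the algorithm are independent. **Atomic steps** (each takes partitions $\lambda,\mu,\kappa$ and a parameter $\xi\ge 0$ and returns a partition $\nu$; convention $\lambda_0=\infty$). - sampleHH$(\lambda,\mu,\kappa,\xi)$: draw $G\sim Geom(\xi)$; return $\nu$ with $\nu_1=\max(\lambda_1,\mu_1)+G$ and $\nu_i=\max(\lambda_i,\mu_i)+\min(\lambda_{i-1},\mu_{i-1})-\kappa_{i-1}$ for $i>1$. - sampleVV$(\lambda,\mu,\kappa,\xi)$: return the conjugate of sampleHH$(\lambda',\mu',\kappa',\xi)$. - sampleHV$(\lambda,\mu,\kappa,\xi)$: draw $B\sim Bernoulli(\xi/(1+\xi))$. For $i=1,\dots,\max(\ell(\lambda),\ell(\mu))+1$ successively: if $\lambda_i\le\mu_i<\lambda_{i-1}$ set $\nu_i=\max(\lambda_i,\mu_i)+B$ with the current value of $B$, else set $\nu_i=\max(\lambda_i,\mu_i)$; then, if $\mu_{i+1}<\lambda_i\le\mu_i$, reassign $B:=\min(\lambda_i,\mu_i)-\kappa_i$. Return $\nu$ (further parts are $0$). - sampleVH$(\lambda,\mu,\kappa,\xi)$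 := sampleHV$(\mu,\lambda,\kappa,\xi)$. **Precomputation.** Let $m$ (resp. $n$) be the number of letters of $w$ in $\{\prec,\prec'\}$ (resp. $\{\succ,\succ'\}$). Let $i_1<\dots<i_m$ be the positions of letters in $\{\prec,\prec'\}$ and $j_n<\dots<j_1$ the positions of the letters in $\{\succ,\succ'\}$ (so $j_1$ is the rightmost). Set $u_k=w_{i_k}$, $x_k=z_{i_k}$ ($1\le k\le m$), $v_k=w_{j_k}$, $y_k=z_{j_k}$ ($1\le k\le n$). The encoded shape $\pi=sh(w)$ is the partition whose $j$-th part $\pi_j$ ($1\le j\le n$) is the number of letters of $w$ in $\{\prec,\prec'\}$ lying to the left of position $j_j$, i.e. of the letter $v_j$. Its boxes are the pairs $(i,j)$ with $1\le j\le\ell(\pi)$, $1\le i\le\pi_j$. The type of the box $(i,j)$ is HH, VV, HV or VH according to whether $(u_i,v_j)$ is $(\prec,\succ)$, $(\prec',\succ')$, $(\prec,\succ')$ or $(\prec',\succ)$. **Algorithm SchurSample.** Initialize $\tau(i,0)=\tau(0,j)=\emptyset$ for $0\le i\le m$, $0\le j\le n$. For $j=1,\dots,\ell(\pi)$, for $i=1,\dots,\pi_j$: set $\tau(i,j)=\mathrm{sample}T(\tau(i-1,j),\tau(i,j-1),\tau(i-1,j-1),x_iy_j)$, where $T\in\{HH,HV,VH,VV\}$ is the type of $(i,j)$. Output $\Lambda=(\tau(l_0),\tau(l_1),\dots,\tau(l_{m+n}))$, where $l_0=(0,n)$ and, for $k=1,\dots,m+n$, $l_k=l_{k-1}+(1,0)$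 if $w_k\in\{\prec,\prec'\}$ and $l_k=l_{k-1}-(0,1)$ if $w_k\in\{\succ,\succ'\}$ (so $l_{m+n}=(m,0)$; these are the lattice points on the boundary of $\pi$). *)

theory Defs
  imports "HOL-Probability.Probability"
begin

section \<open>Partitions\<close>

text \<open>
  Sequences are indexed from \<open>0\<close>: the part \<open>\<lambda>\<^sub>i\<close> of the usual notation (\<open>i \<ge> 1\<close>) is the value
  at \<open>i - 1\<close>. The operations below are total functions on all sequences of naturals and are
  meaningful on those satisfying \<open>is_partition\<close>.
\<close>

type_synonym seq = "nat \<Rightarrow> nat"

definition is_partition :: "seq \<Rightarrow> bool" where
  "is_partition la \<longleftrightarrow> (\<forall>i. la (Suc i) \<le> la i) \<and> finite {i. la i \<noteq> 0}"

definition empty_part :: seq where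
  "empty_part = (\<lambda>_. 0)"

definition len_part :: "seq \<Rightarrow> nat" where
  "len_part la = card {i. 0 < la i}"

definition size_part :: "seq \<Rightarrow> nat" where
  "size_part la = (\<Sum>i | la i \<noteq> 0. la i)"

text \<open>With \<open>0\<close>-based indices, \<open>\<lambda>'\<^sub>i = |{j. \<lambda>\<^sub>j \<ge> i}|\<close> reads as follows.\<close>

definition conj_part :: "seq \<Rightarrow> seq" where
  "conj_part la = (\<lambda>i. card {j. Suc i \<le> la j})"

definition interl :: "seq \<Rightarrow> seq \<Rightarrow> bool" where
  "interl mu la \<longleftrightarrow> (\<forall>i. mu i \<le> la i \<and> la (Suc i) \<le> mu i)"

definition interl' :: "seq \<Rightarrow> seq \<Rightarrow> bool" where
  "interl' mu la \<longleftrightarrow> interl (conj_part mu) (conj_part la)"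


section \<open>Words and the Schur process\<close>

text \<open>
  The letters \<open>Prec\<close>, \<open>Succ\<close>, \<open>Prec'\<close>, \<open>Succ'\<close> are \<open>\<prec>\<close>, \<open>\<succ>\<close>, \<open>\<prec>'\<close>, \<open>\<succ>'\<close>. The letter \<open>w\<^sub>i\<close> is \<open>w ! (i - 1)\<close>,
  and likewise for the parameters.
\<close>

datatype letter = Prec | Succ | Prec' | Succ'

fun letter_rel :: "letter \<Rightarrow> seq \<Rightarrow> seq \<Rightarrow> bool" where
  "letter_rel Prec la mu = interl la mu"
| "letter_rel Succ la mu = interl mu la"
| "letter_rel Prec' la mu = interl' la mu"
| "letter_rel Succ' la mu = interl' mu la"

definition interlaced :: "letter list \<Rightarrow> seq list \<Rightarrow> bool" where
  "interlaced w L \<longleftrightarrow>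
     length L = length w + 1 \<and> (\<forall>la\<in>set L. is_partition la) \<and>
     L ! 0 = empty_part \<and> L ! length w = empty_part \<and>
     (\<forall>i<length w. letter_rel (w ! i) (L ! i) (L ! Suc i))"

definition schur_weight :: "real list \<Rightarrow> seq list \<Rightarrow> real" where
  "schur_weight z L =
     (\<Prod>i<length z. (z ! i) ^ nat \<bar>int (size_part (L ! Suc i)) - int (size_part (L ! i))\<bar>)"

text \<open>
  \<open>is_schur_process w z p\<close>: the probability distribution \<open>p\<close> is supported on \<open>w\<close>-interlaced sequences
  and is proportional to the weight there. There is at most one such \<open>p\<close>, and the constant \<open>c\<close> is
  necessarily the inverse of the total weight.
\<close>

definition is_schur_process :: "letter list \<Rightarrow> real list \<Rightarrow> seq list pmf \<Rightarrow> bool" where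
  "is_schur_process w z p \<longleftrightarrow>
     (\<exists>c>0. \<forall>L. pmf p L = (if interlaced w L then c * schur_weight z L else 0))"


section \<open>Atomic sampling steps\<close>

definition Geom :: "real \<Rightarrow> nat pmf" where
  "Geom xi = geometric_pmf (1 - xi)"

text \<open>
  The subtractions on natural numbers below never truncate on the arguments supplied by the
  algorithm, because there \<open>\<kappa>\<close> is contained in both \<open>\<lambda>\<close> and \<open>\<mu>\<close>.
\<close>

definition sampleHH :: "seq \<Rightarrow> seq \<Rightarrow> seq \<Rightarrow> real \<Rightarrow> seq pmf" where
  "sampleHH la mu ka xi =
     map_pmf (\<lambda>G i. if i = 0 then max (la 0) (mu 0) + G
                    else max (la i) (mu i) + min (la (i - 1)) (mu (i - 1)) - ka (i - 1))
       (Geom xi)"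

definition sampleVV :: "seq \<Rightarrow> seq \<Rightarrow> seq \<Rightarrow> real \<Rightarrow> seq pmf" where
  "sampleVV la mu ka xi = map_pmf conj_part (sampleHH (conj_part la) (conj_part mu) (conj_part ka) xi)"

text \<open>
  One pass of the loop in the mixed case; the state is the partially filled \<open>\<nu>\<close> and the current
  value of \<open>B\<close>. The disjunct \<open>i = 0\<close> encodes the convention \<open>\<lambda>\<^sub>0 = \<infinity>\<close>.
\<close>

definition HV_step :: "seq \<Rightarrow> seq \<Rightarrow> seq \<Rightarrow> nat \<Rightarrow> seq \<times> nat \<Rightarrow> seq \<times> nat" where
  "HV_step la mu ka i = (\<lambda>(nu, B).
     (nu(i := if la i \<le> mu i \<and> (i = 0 \<or> mu i < la (i - 1))
              then max (la i) (mu i) + B else max (la i) (mu i)),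
      if mu (Suc i) < la i \<and> la i \<le> mu i then min (la i) (mu i) - ka i else B))"

definition sampleHV :: "seq \<Rightarrow> seq \<Rightarrow> seq \<Rightarrow> real \<Rightarrow> seq pmf" where
  "sampleHV la mu ka xi =
     map_pmf (\<lambda>b. fst (fold (HV_step la mu ka) [0..<max (len_part la) (len_part mu) + 1]
                         (\<lambda>_. 0, of_bool b)))
       (bernoulli_pmf (xi / (1 + xi)))"

definition sampleVH :: "seq \<Rightarrow> seq \<Rightarrow> seq \<Rightarrow> real \<Rightarrow> seq pmf" where
  "sampleVH la mu ka xi = sampleHV mu la ka xi"

text \<open>The step for a box whose letters are \<open>u\<^sub>i\<close> and \<open>v\<^sub>j\<close>; no other pairs of letters occur.\<close>

fun sample :: "letter \<Rightarrow> letter \<Rightarrow> seq \<Rightarrow> seq \<Rightarrow> seq \<Rightarrow> real \<Rightarrow> seq pmf" where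
  "sample Prec Succ = sampleHH"
| "sample Prec' Succ' = sampleVV"
| "sample Prec Succ' = sampleHV"
| "sample Prec' Succ = sampleVH"


section \<open>Encoded shape\<close>

definition up_positions :: "letter list \<Rightarrow> nat list" where
  "up_positions w = filter (\<lambda>k. w ! k \<in> {Prec, Prec'}) [0..<length w]"

definition down_positions :: "letter list \<Rightarrow> nat list" where
  "down_positions w = rev (filter (\<lambda>k. w ! k \<in> {Succ, Succ'}) [0..<length w])"

text \<open>The indices \<open>i\<close> and \<open>j\<close> of \<open>u\<^sub>i\<close>, \<open>x\<^sub>i\<close>, \<open>v\<^sub>j\<close>, \<open>y\<^sub>j\<close> and of the boxes \<open>(i, j)\<close> start at \<open>1\<close>.\<close>

definition u_letter :: "letter list \<Rightarrow> nat \<Rightarrow> letter" where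
  "u_letter w i = w ! (up_positions w ! (i - 1))"

definition x_param :: "letter list \<Rightarrow> real list \<Rightarrow> nat \<Rightarrow> real" where
  "x_param w z i = z ! (up_positions w ! (i - 1))"

definition v_letter :: "letter list \<Rightarrow> nat \<Rightarrow> letter" where
  "v_letter w j = w ! (down_positions w ! (j - 1))"

definition y_param :: "letter list \<Rightarrow> real list \<Rightarrow> nat \<Rightarrow> real" where
  "y_param w z j = z ! (down_positions w ! (j - 1))"

definition sh :: "letter list \<Rightarrow> seq" where
  "sh w = (\<lambda>j. if j < length (down_positions w)
               then card {k. k < down_positions w ! j \<and> w ! k \<in> {Prec, Prec'}} else 0)"

definition boxes :: "letter list \<Rightarrow> (nat \<times> nat) set" where
  "boxes w = {(i, j). 1 \<le> j \<and> j \<le> len_part (sh w) \<and> 1 \<le> i \<and> i \<le> sh w (j - 1)}"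


section \<open>The algorithm\<close>

type_synonym table = "nat \<times> nat \<Rightarrow> seq"

definition init_table :: table where
  "init_table = (\<lambda>(i, j). if i = 0 \<or> j = 0 then empty_part else undefined)"

definition sample_box :: "letter list \<Rightarrow> real list \<Rightarrow> nat \<times> nat \<Rightarrow> table \<Rightarrow> table pmf" where
  "sample_box w z = (\<lambda>(i, j) tau.
     map_pmf (\<lambda>nu. tau((i, j) := nu))
       (sample (u_letter w i) (v_letter w j)
          (tau (i - 1, j)) (tau (i, j - 1)) (tau (i - 1, j - 1)) (x_param w z i * y_param w z j)))"

primrec sample_boxes :: "letter list \<Rightarrow> real list \<Rightarrow> (nat \<times> nat) list \<Rightarrow> table \<Rightarrow> table pmf" where
  "sample_boxes w z [] tau = return_pmf tau"
| "sample_boxes w z (b # bs) tau = bind_pmf (sample_box w z b tau) (sample_boxes w z bs)"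

text \<open>The lattice path starting at the given point whose steps are prescribed by the word.\<close>

primrec lattice_path :: "letter list \<Rightarrow> nat \<times> nat \<Rightarrow> (nat \<times> nat) list" where
  "lattice_path [] l = [l]"
| "lattice_path (a # w) l =
     l # lattice_path w (if a \<in> {Prec, Prec'} then (fst l + 1, snd l) else (fst l, snd l - 1))"

text \<open>The algorithm with the double loop replaced by a loop over the given list of boxes.\<close>

definition SchurSample_along :: "(nat \<times> nat) list \<Rightarrow> letter list \<Rightarrow> real list \<Rightarrow> seq list pmf" where
  "SchurSample_along bs w z =
     map_pmf (\<lambda>tau. map tau (lattice_path w (0, length (down_positions w))))
       (sample_boxes w z bs init_table)"

definition SchurSample :: "letter list \<Rightarrow> real list \<Rightarrow> seq list pmf" where
  "SchurSample w z =
     SchurSample_along [(i, j). j \<leftarrow> [1..<len_part (sh w) + 1], i \<leftarrow> [1..<sh w (j - 1) + 1]] w z"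

definition admissible_order :: "letter list \<Rightarrow> (nat \<times> nat) list \<Rightarrow> bool" where
  "admissible_order w bs \<longleftrightarrow>
     distinct bs \<and> set bs = boxes w \<and>
     (\<forall>p<length bs. \<forall>q<length bs.
        bs ! p \<noteq> bs ! q \<and> fst (bs ! p) \<le> fst (bs ! q) \<and> snd (bs ! p) \<le> snd (bs ! q) \<longrightarrow> p < q)"

end

theory Submission
  imports Defs
begin

text \<open>
  Adding one box to a shape means replacing a factor \<open>d u\<close> of a word (a descending letter directly
  followed by an ascending one) by \<open>u d\<close>. Sequences interlaced for the two words differ only in
  their entry at this corner: \<open>\<kappa>\<close> below its neighbours \<open>\<lambda>\<close>, \<open>\<mu>\<close> in the one case, \<open>\<nu>\<close> above them in
  the other. For each of the four kinds of boxes there is a bijection between the pairs \<open>(\<kappa>, g)\<close>,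
  with \<open>g\<close> ranging over all naturals or over \<open>{0, 1}\<close>, and the partitions \<open>\<nu>\<close>, such that
  \<open>|\<nu>| + |\<kappa>| = |\<lambda>| + |\<mu>| + g\<close> (\<open>growth_rule_HH\<close>, \<open>growth_rule_HV\<close>, and their images under
  conjugation and under exchange of \<open>\<lambda>\<close> and \<open>\<mu>\<close>). The atomic step computes this bijection on a \<open>g\<close>
  drawn with probability proportional to \<open>(x y)\<^sup>g\<close> (\<open>sample_by_growth_rule\<close>).

  The size identity turns the weight \<open>y\<close> to the power \<open>|\<lambda>| - |\<kappa>|\<close> times \<open>x\<close> to the power \<open>|\<mu>| - |\<kappa>|\<close>
  of the old corner, multiplied by \<open>(x y)\<^sup>g\<close>, into the weight of the new corner, \<open>x\<close> to the power
  \<open>|\<nu>| - |\<lambda>|\<close> times \<open>y\<close> to the power \<open>|\<nu>| - |\<mu>|\<close>. Hence resampling the corner carries the Schur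
  process of the word with \<open>d u\<close> to that of the word with \<open>u d\<close>, with the two parameters exchanged
  along with the letters (\<open>is_schur_process_exchange\<close>).

  The theorem follows by induction on the list of boxes, for all words at once. The last box of an
  admissible order is maximal among all boxes, hence it comes from two adjacent letters \<open>u d\<close>
  (\<open>corner_decomposition\<close>), and the remaining list is an admissible order for the word in which
  these letters are exchanged. Sampling the last box is the resampling of that corner of the path
  (\<open>SchurSample_along_snoc\<close>). With no boxes left, all descending letters come first, and the
  sequence of empty partitions is the only interlaced one. The double loop is one of the admissible
  orders.
\<close>

section \<open>Conjugation of partitions\<close>

lemma is_partition_antimono: "is_partition la \<Longrightarrow> i \<le> j \<Longrightarrow> la j \<le> la i"
  by (rule lift_Suc_antimono_le[of la]) (auto simp: is_partition_def)

lemma finite_down_closed_eq: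
  fixes A :: "nat set"
  assumes fin: "finite A" and down: "\<And>i j. j \<in> A \<Longrightarrow> i \<le> j \<Longrightarrow> i \<in> A"
  shows "A = {..<card A}"
proof (rule card_subset_eq)
  show "A \<subseteq> {..<card A}"
  proof
    fix i assume i: "i \<in> A"
    then have "{..i} \<subseteq> A" using down by blast
    from card_mono[OF fin this] show "i \<in> {..<card A}" by simp
  qed
qed auto

lemma part_nonzero_iff_less_len:
  assumes "is_partition la"
  shows "la i \<noteq> 0 \<longleftrightarrow> i < len_part la"
proof -
  have "{i. 0 < la i} = {..<card {i. 0 < la i}}"
  proof (rule finite_down_closed_eq)
    show "finite {i. 0 < la i}" using assms by (simp add: is_partition_def)
    fix i j assume "j \<in> {i. 0 < la i}" "i \<le> j"
    then show "i \<in> {i. 0 < la i}" using is_partition_antimono[OF assms] by fastforce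
  qed
  then show ?thesis unfolding len_part_def by blast
qed

text \<open>
  The parts larger than \<open>i\<close> form an initial segment of length \<open>\<lambda>'\<^sub>i\<close>. In this symmetric form,
  conjugation is visibly the reflection of the diagram \<open>{(i, j). i < \<lambda>\<^sub>j}\<close>.
\<close>

lemma less_conj_part_iff:
  assumes "is_partition la"
  shows "j < conj_part la i \<longleftrightarrow> i < la j"
proof -
  have "is_partition (\<lambda>j. la j - i)"
    using assms by (auto simp: is_partition_def intro: diff_le_mono elim: rev_finite_subset)
  from part_nonzero_iff_less_len[OF this, of j]
  have "i < la j \<longleftrightarrow> j < card {j. i < la j}" by (simp add: len_part_def not_le)
  then show ?thesis by (simp add: conj_part_def Suc_le_eq)
qed

lemma conj_part_is_partition:
  assumes "is_partition la"
  shows "is_partition (conj_part la)"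
proof -
  have "conj_part la (Suc i) \<le> conj_part la i" for i
    using less_conj_part_iff[OF assms, of "conj_part la i" "Suc i"]
      less_conj_part_iff[OF assms, of "conj_part la i" i] by linarith
  moreover have "{i. conj_part la i \<noteq> 0} = {..<la 0}"
    using less_conj_part_iff[OF assms, of 0] by auto
  ultimately show ?thesis by (simp add: is_partition_def)
qed

lemma conj_part_conj_part:
  assumes "is_partition la"
  shows "conj_part (conj_part la) = la"
proof
  fix j
  have "k < conj_part (conj_part la) j \<longleftrightarrow> k < la j" for k
    by (simp add: less_conj_part_iff conj_part_is_partition assms)
  then show "conj_part (conj_part la) j = la j"
    by (metis linorder_neqE_nat order.irrefl)
qed

text \<open>The size is the number of cells of the diagram, and conjugation reflects the diagram.\<close>

lemma size_part_conj_part: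
  assumes "is_partition la"
  shows "size_part (conj_part la) = size_part la"
proof -
  have cells: "size_part ka = card {(i, j). j < ka i}" if "is_partition ka" for ka
  proof -
    have "{(i, j). j < ka i} = (SIGMA i:{i. ka i \<noteq> 0}. {..<ka i})" by auto
    then show ?thesis
      using that by (simp add: size_part_def is_partition_def)
  qed
  have "{(i, j). j < conj_part la i} = prod.swap ` {(i, j). j < la i}"
    by (auto simp: less_conj_part_iff assms image_iff)
  then show ?thesis
    by (simp add: cells conj_part_is_partition assms card_image)
qed

lemma size_part_eq_sum:
  assumes "\<And>i. n \<le> i \<Longrightarrow> la i = 0"
  shows "size_part la = sum la {..<n}"
  unfolding size_part_def
  by (rule sum.mono_neutral_left) (use assms in \<open>auto intro: ccontr\<close>)

lemma common_zero_index:
  assumes "is_partition la" "is_partition mu"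
  obtains n where "\<And>i. n \<le> i \<Longrightarrow> la i = 0" "\<And>i. n \<le> i \<Longrightarrow> mu i = 0"
    "n = max (len_part la) (len_part mu)"
  using part_nonzero_iff_less_len[OF assms(1)] part_nonzero_iff_less_len[OF assms(2)]
  by (metis max.boundedE not_le)

text \<open>
  Both inequalities between columns are tested cell by cell; read along the rows, they say that
  each row grows by at most one cell.
\<close>

lemma interl'_iff:
  assumes "is_partition mu" "is_partition la"
  shows "interl' mu la \<longleftrightarrow> (\<forall>i. mu i \<le> la i \<and> la i \<le> mu i + 1)"
proof -
  have le_iff: "m \<le> n \<longleftrightarrow> (\<forall>j<m. j < n)" for m n :: nat
    by (meson order.strict_trans2 order.irrefl not_le_imp_less)
  have "conj_part mu i \<le> conj_part la i \<longleftrightarrow> (\<forall>j. i < mu j \<longrightarrow> i < la j)" for i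
    by (simp add: le_iff less_conj_part_iff assms)
  moreover have "conj_part la (Suc i) \<le> conj_part mu i \<longleftrightarrow> (\<forall>j. Suc i < la j \<longrightarrow> i < mu j)" for i
    by (simp add: le_iff less_conj_part_iff assms)
  ultimately have *: "interl' mu la \<longleftrightarrow>
      (\<forall>i j. (i < mu j \<longrightarrow> i < la j) \<and> (Suc i < la j \<longrightarrow> i < mu j))"
    unfolding interl'_def interl_def by blast
  show ?thesis
  proof
    assume "interl' mu la"
    with * have a: "i < mu j \<Longrightarrow> i < la j" and b: "Suc i < la j \<Longrightarrow> i < mu j" for i j by blast+
    show "\<forall>i. mu i \<le> la i \<and> la i \<le> mu i + 1"
    proof
      fix i show "mu i \<le> la i \<and> la i \<le> mu i + 1"
        using a[of "la i" i] b[of "mu i" i] by linarith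
    qed
  next
    assume r: "\<forall>i. mu i \<le> la i \<and> la i \<le> mu i + 1"
    show "interl' mu la"
      unfolding * 
    proof (intro allI conjI impI)
      fix i j
      show "i < la j" if "i < mu j" using r[rule_format, of j] that by linarith
      show "i < mu j" if "Suc i < la j" using r[rule_format, of j] that by linarith
    qed
  qed
qed

text \<open>
  Interlacing with a partition forces monotonicity and finite support, so for the growth maps
  below only inequalities between parts have to be verified.
\<close>

lemma interl_is_partition:
  assumes "interl mu la" "is_partition mu"
  shows "is_partition la"
proof -
  have le: "mu i \<le> la i" "la (Suc i) \<le> mu i" for i
    using assms(1) by (auto simp: interl_def)
  obtain n where n: "\<And>i. n \<le> i \<Longrightarrow> mu i = 0"
    using common_zero_index[OF assms(2,2)] by blast
  have "la i = 0" if "Suc n \<le> i" for i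
    using le(2)[of "i - 1"] n[of "i - 1"] that by simp
  then have "i \<in> {..n}" if "la i \<noteq> 0" for i
    using that by (cases "Suc n \<le> i") auto
  then have "{i. la i \<noteq> 0} \<subseteq> {..n}" by blast
  moreover have "la (Suc i) \<le> la i" for i
    using le[of i] by linarith
  ultimately show ?thesis
    unfolding is_partition_def using finite_subset finite_atMost by blast
qed

lemma interl_is_partition_lower:
  assumes "interl mu la" "is_partition la"
  shows "is_partition mu"
proof -
  have le: "mu i \<le> la i" "la (Suc i) \<le> mu i" for i
    using assms(1) by (auto simp: interl_def)
  have "{i. mu i \<noteq> 0} \<subseteq> {i. la i \<noteq> 0}"
  proof
    fix i assume "i \<in> {i. mu i \<noteq> 0}"
    then show "i \<in> {i. la i \<noteq> 0}" using le(1)[of i] by simp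
  qed
  moreover have "mu (Suc i) \<le> mu i" for i
    using le(2)[of i] le(1)[of "Suc i"] by linarith
  ultimately show ?thesis
    using assms(2) finite_subset unfolding is_partition_def by blast
qed

section \<open>Growth rules\<close>

text \<open>
  The map \<open>F\<close> fills the fourth corner of a unit square. The relations \<open>R\<close> and \<open>Q\<close>, both with the
  smaller partition as first argument, hold across the sides in the direction of the ascending
  and of the descending letter: \<open>R \<kappa> \<mu>\<close>, \<open>R \<lambda> \<nu>\<close> and \<open>Q \<kappa> \<lambda>\<close>, \<open>Q \<mu> \<nu>\<close>. This is the local rule of an
  insertion algorithm of Robinson-Schensted-Knuth type, with \<open>g \<in> S\<close> the entry in the square.
\<close>

definition growth_rule ::
  "(seq \<Rightarrow> seq \<Rightarrow> bool) \<Rightarrow> (seq \<Rightarrow> seq \<Rightarrow> bool) \<Rightarrow> nat set \<Rightarrow> (seq \<Rightarrow> seq \<Rightarrow> seq \<Rightarrow> nat \<Rightarrow> seq) \<Rightarrow> bool" where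
  "growth_rule R Q S F \<longleftrightarrow> (\<forall>la mu. is_partition la \<longrightarrow> is_partition mu \<longrightarrow>
     bij_betw (\<lambda>(ka, g). F la mu ka g)
       ({ka. is_partition ka \<and> Q ka la \<and> R ka mu} \<times> S) {nu. is_partition nu \<and> R la nu \<and> Q mu nu} \<and>
     (\<forall>ka g. is_partition ka \<longrightarrow> Q ka la \<longrightarrow> R ka mu \<longrightarrow> g \<in> S \<longrightarrow>
        size_part (F la mu ka g) + size_part ka = size_part la + size_part mu + g))"

lemma growth_rule_swap:
  assumes "growth_rule R Q S F"
  shows "growth_rule Q R S (\<lambda>la mu. F mu la)"
proof -
  have "{ka. is_partition ka \<and> R ka mu \<and> Q ka la} = {ka. is_partition ka \<and> Q ka la \<and> R ka mu}"
    "{nu. is_partition nu \<and> Q mu nu \<and> R la nu} = {nu. is_partition nu \<and> R la nu \<and> Q mu nu}" for la mu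
    by auto
  with assms show ?thesis
    unfolding growth_rule_def by (simp add: add.commute)
qed

definition HH_insert :: "seq \<Rightarrow> seq \<Rightarrow> seq \<Rightarrow> nat \<Rightarrow> seq" where
  "HH_insert la mu ka g = (\<lambda>i. if i = 0 then max (la 0) (mu 0) + g
     else max (la i) (mu i) + min (la (i - 1)) (mu (i - 1)) - ka (i - 1))"

text \<open>
  The first part of \<open>\<nu>\<close> is free above \<open>max \<lambda>\<^sub>0 \<mu>\<^sub>0\<close>, which accounts for \<open>g\<close>. Every \<open>\<kappa>\<^sub>i\<close> and every
  \<open>\<nu>\<^sub>i\<^sub>+\<^sub>1\<close> ranges independently over the same interval, from \<open>max \<lambda>\<^sub>i\<^sub>+\<^sub>1 \<mu>\<^sub>i\<^sub>+\<^sub>1\<close> to \<open>min \<lambda>\<^sub>i \<mu>\<^sub>i\<close>, and the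
  rule is the reflection of this interval.
\<close>

lemma growth_rule_HH: "growth_rule interl interl UNIV HH_insert"
  unfolding growth_rule_def
proof (intro allI impI conjI)
  fix la mu assume la: "is_partition la" and mu: "is_partition mu"
  let ?K = "{ka. is_partition ka \<and> interl ka la \<and> interl ka mu}"
  let ?N = "{nu. is_partition nu \<and> interl la nu \<and> interl mu nu}"
  let ?f = "\<lambda>(ka, g). HH_insert la mu ka g"
  let ?inv = "\<lambda>nu. (\<lambda>i. max (la (Suc i)) (mu (Suc i)) + min (la i) (mu i) - nu (Suc i),
                    nu 0 - max (la 0) (mu 0))"
  have bd: "max (la (Suc i)) (mu (Suc i)) \<le> ka i" "ka i \<le> min (la i) (mu i)" if "ka \<in> ?K" for ka i
    using that by (auto simp: interl_def)
  have bd': "max (la i) (mu i) \<le> nu i" "nu (Suc i) \<le> min (la i) (mu i)" if "nu \<in> ?N" for nu i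
    using that by (auto simp: interl_def)
  show "bij_betw ?f (?K \<times> UNIV) ?N"
  proof (rule bij_betw_byWitness[where f' = ?inv])
    show "\<forall>a\<in>?K \<times> UNIV. ?inv (?f a) = a"
    proof
      fix a assume "a \<in> ?K \<times> (UNIV :: nat set)"
      then obtain ka g where a: "a = (ka, g)" and "ka \<in> ?K" by blast
      from bd[OF this(2)] have "a + b - (a + b - ka i) = ka i"
        if "a = max (la (Suc i)) (mu (Suc i))" "b = min (la i) (mu i)" for a b i
        using that by (meson diff_diff_cancel trans_le_add2)
      then show "?inv (?f a) = a"
        by (simp add: a HH_insert_def fun_eq_iff)
    qed
    show "\<forall>nu\<in>?N. ?f (?inv nu) = nu"
    proof
      fix nu assume nu: "nu \<in> ?N"
      show "?f (?inv nu) = nu"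
      proof
        fix i show "?f (?inv nu) i = nu i"
        proof (cases i)
          case 0 then show ?thesis
            using bd'(1)[OF nu, of 0] by (simp add: HH_insert_def)
        next
          case (Suc k)
          have "a + b - (a + b - nu i) = nu i" if "b = min (la k) (mu k)" for a b
            using bd'(2)[OF nu, of k] that Suc by (meson diff_diff_cancel trans_le_add2)
          with Suc show ?thesis by (simp add: HH_insert_def)
        qed
      qed
    qed
    show "?f ` (?K \<times> UNIV) \<subseteq> ?N"
    proof (rule image_subsetI)
      fix a assume "a \<in> ?K \<times> (UNIV :: nat set)"
      then obtain ka g where a: "a = (ka, g)" and ka: "ka \<in> ?K" by blast
      have "max (la i) (mu i) \<le> HH_insert la mu ka g i" for i
      proof (cases i)
        case (Suc k)
        then show ?thesis using bd(2)[OF ka, of k] unfolding HH_insert_def by (simp add: le_diff_conv2 trans_le_add2 del: min.bounded_iff max.bounded_iff)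
      qed (simp add: HH_insert_def)
      moreover have "HH_insert la mu ka g (Suc i) \<le> min (la i) (mu i)" for i
        using bd(1)[OF ka, of i] by (simp add: HH_insert_def del: max.bounded_iff min.bounded_iff)
      ultimately have "interl la (HH_insert la mu ka g)" "interl mu (HH_insert la mu ka g)"
        by (simp_all add: interl_def)
      with interl_is_partition[OF this(1) la]
      show "?f a \<in> ?N" by (simp add: a)
    qed
    show "?inv ` ?N \<subseteq> ?K \<times> UNIV"
    proof (rule image_subsetI)
      fix nu assume nu: "nu \<in> ?N"
      let ?ka = "\<lambda>i. max (la (Suc i)) (mu (Suc i)) + min (la i) (mu i) - nu (Suc i)"
      have "max (la (Suc i)) (mu (Suc i)) \<le> ?ka i \<and> ?ka i \<le> min (la i) (mu i)" for i
        using bd'(1)[OF nu, of "Suc i"] bd'(2)[OF nu, of i] by linarith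
      then have "interl ?ka la" "interl ?ka mu"
        by (auto simp: interl_def)
      with interl_is_partition_lower[OF this(1) la]
      show "?inv nu \<in> ?K \<times> UNIV" by simp
    qed
  qed
  fix ka g assume ka: "is_partition ka" "interl ka la" "interl ka mu"
  then have kaK: "ka \<in> ?K" by simp
  obtain n where n: "\<And>i. n \<le> i \<Longrightarrow> la i = 0" "\<And>i. n \<le> i \<Longrightarrow> mu i = 0"
    using common_zero_index[OF la mu] by blast
  have zero: "ka i = 0" "HH_insert la mu ka g (Suc i) = 0" if "n \<le> i" for i
    using bd(2)[OF kaK, of i] n that by (auto simp: HH_insert_def)
  have "sum (HH_insert la mu ka g) {..<Suc k} + sum ka {..<k} =
      sum la {..<k} + sum mu {..<k} + max (la k) (mu k) + g" for k
  proof (induction k)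
    case 0 then show ?case by (simp add: HH_insert_def)
  next
    case (Suc k)
    have "HH_insert la mu ka g (Suc k) + ka k = max (la (Suc k)) (mu (Suc k)) + min (la k) (mu k)"
      using bd(2)[OF kaK, of k]
      by (simp add: HH_insert_def trans_le_add2 del: max.bounded_iff min.bounded_iff)
    moreover have "max (la k) (mu k) + min (la k) (mu k) = la k + mu k" by simp
    ultimately show ?case using Suc unfolding sum.lessThan_Suc by linarith
  qed
  note sums = this[of n]
  have "size_part (HH_insert la mu ka g) = sum (HH_insert la mu ka g) {..<Suc n}"
    by (rule size_part_eq_sum) (metis Suc_le_D Suc_le_mono zero(2))
  with sums show "size_part (HH_insert la mu ka g) + size_part ka = size_part la + size_part mu + g"
    using size_part_eq_sum[of n la] size_part_eq_sum[of n mu] size_part_eq_sum[of n ka] n zero(1)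
    by simp
qed

text \<open>
  Conjugation is an involution on partitions that preserves the size, so every growth rule can be
  transported along it.
\<close>

lemma growth_rule_conj:
  assumes "growth_rule R Q S F"
  shows "growth_rule (\<lambda>mu la. R (conj_part mu) (conj_part la)) (\<lambda>mu la. Q (conj_part mu) (conj_part la)) S
    (\<lambda>la mu ka g. conj_part (F (conj_part la) (conj_part mu) (conj_part ka) g))"
  unfolding growth_rule_def
proof (intro allI impI conjI)
  fix la mu assume la: "is_partition la" and mu: "is_partition mu"
  note la' = conj_part_is_partition[OF la] and mu' = conj_part_is_partition[OF mu]
  let ?la = "conj_part la" and ?mu = "conj_part mu"
  let ?K = "{ka. is_partition ka \<and> Q ka ?la \<and> R ka ?mu}"
  let ?N = "{nu. is_partition nu \<and> R ?la nu \<and> Q ?mu nu}"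
  from assms la' mu' have bij: "bij_betw (\<lambda>(ka, g). F ?la ?mu ka g) (?K \<times> S) ?N"
    and size: "\<And>ka g. ka \<in> ?K \<Longrightarrow> g \<in> S \<Longrightarrow>
      size_part (F ?la ?mu ka g) + size_part ka = size_part ?la + size_part ?mu + g"
    unfolding growth_rule_def by auto
  let ?K' = "{ka. is_partition ka \<and> Q (conj_part ka) ?la \<and> R (conj_part ka) ?mu}"
  let ?N' = "{nu. is_partition nu \<and> R ?la (conj_part nu) \<and> Q ?mu (conj_part nu)}"
  have 1: "bij_betw conj_part ?K' ?K"
    by (rule bij_betw_byWitness[where f' = conj_part])
       (auto simp: conj_part_conj_part conj_part_is_partition)
  have 3: "bij_betw conj_part ?N ?N'"
    by (rule bij_betw_byWitness[where f' = conj_part])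
       (auto simp: conj_part_conj_part conj_part_is_partition)
  have "bij_betw (conj_part \<circ> (\<lambda>(ka, g). F ?la ?mu ka g) \<circ> map_prod conj_part id) (?K' \<times> S) ?N'"
    by (intro bij_betw_trans[OF bij_betw_map_prod[OF 1 bij_betw_id]] bij_betw_trans[OF bij 3])
  then show "bij_betw (\<lambda>(ka, g). conj_part (F ?la ?mu (conj_part ka) g)) (?K' \<times> S) ?N'"
    by (simp add: comp_def case_prod_unfold)
  fix ka g assume ka: "is_partition ka" "Q (conj_part ka) ?la" "R (conj_part ka) ?mu" and g: "g \<in> S"
  then have kaK: "conj_part ka \<in> ?K" by (simp add: conj_part_is_partition)
  have "F ?la ?mu (conj_part ka) g \<in> ?N"
    using bij_betwE[OF bij] kaK g by force
  with size[OF kaK g] show "size_part (conj_part (F ?la ?mu (conj_part ka) g)) + size_part ka =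
      size_part la + size_part mu + g"
    by (simp add: size_part_conj_part ka la mu)
qed

text \<open>
  Row \<open>i\<close> is \<^emph>\<open>open\<close> if the inequality \<open>\<nu>\<^sub>i \<le> \<lambda>\<^sub>i\<^sub>-\<^sub>1\<close> leaves room for \<open>\<nu>\<^sub>i = \<mu>\<^sub>i + 1\<close>.
\<close>

definition HV_open :: "seq \<Rightarrow> seq \<Rightarrow> nat \<Rightarrow> bool" where
  "HV_open la mu i \<longleftrightarrow> i = 0 \<or> mu i < la (i - 1)"

text \<open>
  The bit held by the loop when it reaches row \<open>i\<close>. A row with \<open>\<mu>\<^sub>i\<^sub>+\<^sub>1 < \<lambda>\<^sub>i \<le> \<mu>\<^sub>i\<close> is one where \<open>\<kappa>\<^sub>i\<close> can be
  \<open>\<lambda>\<^sub>i\<close> or \<open>\<lambda>\<^sub>i - 1\<close>; there the bit \<open>\<lambda>\<^sub>i - \<kappa>\<^sub>i\<close> is picked up.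
\<close>

primrec HV_carry :: "seq \<Rightarrow> seq \<Rightarrow> seq \<Rightarrow> nat \<Rightarrow> nat \<Rightarrow> nat" where
  "HV_carry la mu ka B 0 = B"
| "HV_carry la mu ka B (Suc i) =
     (if HV_open la mu (Suc i) \<and> la i \<le> mu i then la i - ka i else HV_carry la mu ka B i)"

definition HV_insert :: "seq \<Rightarrow> seq \<Rightarrow> seq \<Rightarrow> nat \<Rightarrow> seq" where
  "HV_insert la mu ka B = (\<lambda>i. if la i \<le> mu i \<and> HV_open la mu i
     then mu i + HV_carry la mu ka B i else max (la i) (mu i))"

lemma fold_HV_step:
  "fold (HV_step la mu ka) [0..<n] (\<lambda>_. 0, B) =
     (\<lambda>i. if i < n then HV_insert la mu ka B i else 0, HV_carry la mu ka B n)"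
  by (induction n) (auto simp: HV_step_def HV_insert_def HV_open_def fun_eq_iff less_Suc_eq)

text \<open>
  No row beyond the loop bound is open, so cutting off the recursion there loses nothing. The
  bound must exceed the number of parts by one, because the last open row can be a row of zeros.
\<close>

lemma sampleHV_eq:
  assumes "is_partition la" "is_partition mu"
  shows "sampleHV la mu ka xi =
    map_pmf (HV_insert la mu ka) (map_pmf of_bool (bernoulli_pmf (xi / (1 + xi))))"
proof -
  obtain n where n: "\<And>i. n \<le> i \<Longrightarrow> la i = 0" "\<And>i. n \<le> i \<Longrightarrow> mu i = 0"
    and n_def: "n = max (len_part la) (len_part mu)"
    using common_zero_index[OF assms] by blast
  have "HV_insert la mu ka B i = 0" if "\<not> i < n + 1" for B i
    using n(1)[of i] n(1)[of "i - 1"] n(2)[of i] that by (simp add: HV_insert_def HV_open_def)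
  then have "(\<lambda>i. if i < n + 1 then HV_insert la mu ka B i else 0) = HV_insert la mu ka B" for B
    by (simp add: fun_eq_iff)
  then show ?thesis
    unfolding sampleHV_def fold_HV_step n_def[symmetric] by (simp add: pmf.map_comp comp_def)
qed

lemma interl_interl'_lower_iff:
  assumes "is_partition la" "is_partition mu"
  shows "is_partition ka \<and> interl' ka la \<and> interl ka mu \<longleftrightarrow>
    (\<forall>i. ka i \<le> la i \<and> la i \<le> ka i + 1 \<and> ka i \<le> mu i \<and> mu (Suc i) \<le> ka i)"
proof
  assume "is_partition ka \<and> interl' ka la \<and> interl ka mu"
  then show "\<forall>i. ka i \<le> la i \<and> la i \<le> ka i + 1 \<and> ka i \<le> mu i \<and> mu (Suc i) \<le> ka i"
    using interl'_iff[OF _ assms(1), of ka] by (simp add: interl_def)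
next
  assume r: "\<forall>i. ka i \<le> la i \<and> la i \<le> ka i + 1 \<and> ka i \<le> mu i \<and> mu (Suc i) \<le> ka i"
  then have "interl ka mu" by (simp add: interl_def)
  with interl_is_partition_lower[OF this assms(2)] r
  show "is_partition ka \<and> interl' ka la \<and> interl ka mu"
    using interl'_iff[OF _ assms(1), of ka] by simp
qed

lemma interl_interl'_upper_iff:
  assumes "is_partition la" "is_partition mu"
  shows "is_partition nu \<and> interl la nu \<and> interl' mu nu \<longleftrightarrow>
    (\<forall>i. la i \<le> nu i \<and> nu (Suc i) \<le> la i \<and> mu i \<le> nu i \<and> nu i \<le> mu i + 1)"
proof
  assume "is_partition nu \<and> interl la nu \<and> interl' mu nu"
  then show "\<forall>i. la i \<le> nu i \<and> nu (Suc i) \<le> la i \<and> mu i \<le> nu i \<and> nu i \<le> mu i + 1"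
    using interl'_iff[OF assms(2), of nu] by (simp add: interl_def)
next
  assume r: "\<forall>i. la i \<le> nu i \<and> nu (Suc i) \<le> la i \<and> mu i \<le> nu i \<and> nu i \<le> mu i + 1"
  then have "interl la nu" by (simp add: interl_def)
  with interl_is_partition[OF this assms(1)] r
  show "is_partition nu \<and> interl la nu \<and> interl' mu nu"
    using interl'_iff[OF assms(2), of nu] by simp
qed

lemma HV_insert_upper:
  assumes K: "\<And>i. ka i \<le> la i \<and> la i \<le> ka i + 1 \<and> ka i \<le> mu i \<and> mu (Suc i) \<le> ka i"
    and la: "is_partition la" and B: "B \<le> 1"
  shows "la i \<le> HV_insert la mu ka B i \<and> HV_insert la mu ka B (Suc i) \<le> la i \<and>
    mu i \<le> HV_insert la mu ka B i \<and> HV_insert la mu ka B i \<le> mu i + 1"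
proof -
  have carry: "HV_carry la mu ka B i \<le> 1" for i
    by (induction i) (use K B in \<open>auto simp: le_diff_conv\<close>)
  have "la i \<le> mu i + 1"
    using K[of i] by linarith
  moreover have "max (la (Suc i)) (mu (Suc i)) \<le> la i"
    using K[of i] is_partition_antimono[OF la, of i "Suc i"] by simp
  ultimately show ?thesis
    using carry[of i] carry[of "Suc i"] by (auto simp: HV_insert_def HV_open_def simp del: HV_carry.simps)
qed

text \<open>
  At an open row the carried bit still waits to be added to a part of \<open>\<nu>\<close>. At a closed row it has
  already been added, although the loop still stores it; so it must be counted at open rows only.
\<close>

lemma HV_size_balance:
  assumes K: "\<And>i. ka i \<le> la i \<and> la i \<le> ka i + 1 \<and> ka i \<le> mu i \<and> mu (Suc i) \<le> ka i"
    and la: "is_partition la"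
  shows "sum (HV_insert la mu ka B) {..<n} + sum ka {..<n} +
      (if HV_open la mu n then HV_carry la mu ka B n else 0) = sum la {..<n} + sum mu {..<n} + B"
proof (induction n)
  case 0 then show ?case by (simp add: HV_open_def)
next
  case (Suc n)
  have "mu n \<le> la (n - 1)" "la n \<le> la (n - 1)" if "n \<noteq> 0"
    using K[of "n - 1"] that is_partition_antimono[OF la, of "n - 1" n] by auto
  then have "HV_insert la mu ka B n + ka n +
      (if HV_open la mu (Suc n) then HV_carry la mu ka B (Suc n) else 0) =
      la n + mu n + (if HV_open la mu n then HV_carry la mu ka B n else 0)"
    using K[of n] by (auto simp: HV_insert_def HV_open_def)
  with Suc show ?case by simp
qed

lemma HV_open_next:
  assumes mu: "is_partition mu" and "\<not> la i \<le> mu i"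
  shows "HV_open la mu (Suc i)"
  using is_partition_antimono[OF mu, of i "Suc i"] assms(2) by (simp add: HV_open_def)

lemma HV_carry_until:
  assumes mu: "is_partition mu" and "HV_open la mu i" "\<And>j. i \<le> j \<Longrightarrow> j < i + k \<Longrightarrow> \<not> la j \<le> mu j"
  shows "HV_open la mu (i + k) \<and> HV_carry la mu ka B (i + k) = HV_carry la mu ka B i"
  using assms(3)
proof (induction k)
  case 0 then show ?case using assms(2) by simp
next
  case (Suc k)
  then have "\<not> la (i + k) \<le> mu (i + k)" by simp
  with Suc HV_open_next[OF mu, of la "i + k"] show ?case by simp
qed

text \<open>
  The row in which a bit carried into an open row \<open>i\<close> is placed.
\<close>

definition HV_next :: "seq \<Rightarrow> seq \<Rightarrow> nat \<Rightarrow> nat" where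
  "HV_next la mu i = (LEAST j. i \<le> j \<and> la j \<le> mu j)"

lemma HV_next:
  assumes la: "is_partition la"
  shows "i \<le> HV_next la mu i" "la (HV_next la mu i) \<le> mu (HV_next la mu i)"
    "i \<le> j \<Longrightarrow> j < HV_next la mu i \<Longrightarrow> \<not> la j \<le> mu j"
proof -
  obtain n where n: "\<And>i. n \<le> i \<Longrightarrow> la i = 0"
    using common_zero_index[OF la la] by blast
  have "i \<le> max i n \<and> la (max i n) \<le> mu (max i n)" using n by simp
  from LeastI[of "\<lambda>j. i \<le> j \<and> la j \<le> mu j", OF this]
  show "i \<le> HV_next la mu i" "la (HV_next la mu i) \<le> mu (HV_next la mu i)"
    by (auto simp: HV_next_def)
  show "\<not> la j \<le> mu j" if "i \<le> j" "j < HV_next la mu i"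
    using not_less_Least[of j "\<lambda>j. i \<le> j \<and> la j \<le> mu j"] that by (simp add: HV_next_def)
qed

lemma HV_next_eq: 
  assumes "is_partition la"
  shows "HV_next la mu i = (if la i \<le> mu i then i else HV_next la mu (Suc i))"
proof (cases "la i \<le> mu i")
  case True then show ?thesis
    using HV_next(1)[OF assms, of i mu] HV_next(3)[OF assms, of i i mu] by fastforce
next
  case False
  then have "i \<le> j \<and> la j \<le> mu j \<longleftrightarrow> Suc i \<le> j \<and> la j \<le> mu j" for j
    by (metis Suc_leD Suc_leI le_neq_implies_less)
  then show ?thesis using False by (simp add: HV_next_def)
qed

text \<open>
  The rows with \<open>\<mu>\<^sub>j < \<lambda>\<^sub>j\<close> neither place nor replace the bit, and they keep the next row open. Thus
  each carried bit can be read off from \<open>\<nu>\<close>, which makes the rule injective and shows how to invert it.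
\<close>

lemma HV_insert_next:
  assumes la: "is_partition la" and mu: "is_partition mu" and "HV_open la mu i"
  shows "HV_insert la mu ka B (HV_next la mu i) = mu (HV_next la mu i) + HV_carry la mu ka B i"
proof -
  define k where "k = HV_next la mu i - i"
  have k: "HV_next la mu i = i + k" using HV_next(1)[OF la, of i mu] by (simp add: k_def)
  have "HV_open la mu (i + k) \<and> HV_carry la mu ka B (i + k) = HV_carry la mu ka B i"
    by (rule HV_carry_until[OF mu assms(3)]) (use HV_next(3)[OF la, of i _ mu] k in auto)
  then show ?thesis
    using HV_next(2)[OF la, of mu i] by (simp add: HV_insert_def k)
qed

text \<open>
  The values of \<open>\<kappa>\<close> and \<open>\<nu>\<close> are forced except for one free bit in certain rows. Going down the rows,
  free rows of \<open>\<nu>\<close> and of \<open>\<kappa>\<close> alternate, beginning and ending with one of \<open>\<nu>\<close>. So \<open>\<nu>\<close> has exactly one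
  free bit more than \<open>\<kappa>\<close>, and the rule hands the bits \<open>B\<close>, and then those of \<open>\<kappa>\<close> in order, to the
  free rows of \<open>\<nu>\<close>.
\<close>

lemma growth_rule_HV: "growth_rule interl interl' {0, 1} HV_insert"
  unfolding growth_rule_def
proof (intro allI impI conjI)
  fix la mu assume la: "is_partition la" and mu: "is_partition mu"
  let ?K = "{ka. is_partition ka \<and> interl' ka la \<and> interl ka mu}"
  let ?N = "{nu. is_partition nu \<and> interl la nu \<and> interl' mu nu}"
  let ?next = "HV_next la mu"
  note K_iff = interl_interl'_lower_iff[OF la mu] and N_iff = interl_interl'_upper_iff[OF la mu]
  have inj: "inj_on (\<lambda>(ka, B). HV_insert la mu ka B) (?K \<times> {0, 1})"
  proof (rule inj_onI, clarify, intro conjI)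
    fix ka B ka' B'
    assume ka: "is_partition ka" "interl' ka la" "interl ka mu"
      and ka': "is_partition ka'" "interl' ka' la" "interl ka' mu"
      and eq: "HV_insert la mu ka B = HV_insert la mu ka' B'"
    have carry: "HV_carry la mu ka B i = HV_carry la mu ka' B' i" if "HV_open la mu i" for i
      using HV_insert_next[OF la mu that, of ka B] HV_insert_next[OF la mu that, of ka' B'] eq by simp
    from this[of 0] show "B = B'" by (simp add: HV_open_def)
    show "ka = ka'"
    proof
      fix i
      have "ka i \<le> la i \<and> la i \<le> ka i + 1 \<and> ka i \<le> mu i \<and> mu (Suc i) \<le> ka i"
        "ka' i \<le> la i \<and> la i \<le> ka' i + 1 \<and> ka' i \<le> mu i \<and> mu (Suc i) \<le> ka' i"
        using K_iff ka ka' by blast+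
      then show "ka i = ka' i"
        using carry[of "Suc i"]
        by (cases "la i \<le> mu i"; cases "mu (Suc i) < la i") (auto simp: HV_open_def)
    qed
  qed
  have into: "HV_insert la mu ka B \<in> ?N" if "ka \<in> ?K" "B \<in> {0, 1}" for ka B
  proof -
    from that(1) K_iff have "ka i \<le> la i \<and> la i \<le> ka i + 1 \<and> ka i \<le> mu i \<and> mu (Suc i) \<le> ka i" for i
      by blast
    from HV_insert_upper[OF this la, of B] that(2) N_iff show ?thesis by auto
  qed
  have onto: "nu \<in> (\<lambda>(ka, B). HV_insert la mu ka B) ` (?K \<times> {0, 1})" if "nu \<in> ?N" for nu
  proof -
    have N: "la i \<le> nu i \<and> nu (Suc i) \<le> la i \<and> mu i \<le> nu i \<and> nu i \<le> mu i + 1" for i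
      using that N_iff by blast
    \<comment> \<open>The bit that an open row i must carry, read off from \<open>\<nu>\<close> at the row where it is placed.\<close>
    define bit where "bit i = nu (?next i) - mu (?next i)" for i
    have bit_le: "bit i \<le> 1" for i unfolding bit_def using N[of "?next i"] by linarith
    define ka where "ka i = (if HV_open la mu (Suc i) \<and> la i \<le> mu i then la i - bit (Suc i)
      else min (la i) (mu i))" for i
    have "ka i \<le> la i \<and> la i \<le> ka i + 1 \<and> ka i \<le> mu i \<and> mu (Suc i) \<le> ka i" for i
      using bit_le[of "Suc i"] N[of i] N[of "Suc i"] is_partition_antimono[OF mu, of i "Suc i"]
      by (auto simp: ka_def HV_open_def min_def)
    then have "ka \<in> ?K" using K_iff by blast
    \<comment> \<open>In a closed row the carry is stale and need not agree with \<open>bit\<close>.\<close>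
    have carry: "HV_carry la mu ka (bit 0) i = bit i" if "HV_open la mu i" for i
      using that
    proof (induction i)
      case 0 then show ?case by simp
    next
      case (Suc i)
      show ?case
      proof (cases "la i \<le> mu i")
        case True
        with Suc.prems bit_le[of "Suc i"] show ?thesis by (auto simp: ka_def HV_open_def)
      next
        case False
        have "HV_open la mu i"
          using False is_partition_antimono[OF la, of "i - 1" i] by (auto simp: HV_open_def)
        with Suc.IH False show ?thesis
          by (simp add: bit_def HV_next_eq[OF la, of mu i])
      qed
    qed
    have "HV_insert la mu ka (bit 0) i = nu i" for i
    proof (cases "la i \<le> mu i \<and> HV_open la mu i")
      case True
      with carry[of i] N[of i] show ?thesis
        by (simp add: HV_insert_def bit_def HV_next_eq[OF la, of mu i])
    next
      case False
      with N[of i] N[of "i - 1"] show ?thesis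
        by (auto simp: HV_insert_def HV_open_def)
    qed
    then have "nu = (\<lambda>(ka, B). HV_insert la mu ka B) (ka, bit 0)" by auto
    moreover have "bit 0 \<in> {0, 1}" using bit_le[of 0] by auto
    ultimately show ?thesis using \<open>ka \<in> ?K\<close> by blast
  qed
  show "bij_betw (\<lambda>(ka, B). HV_insert la mu ka B) (?K \<times> {0, 1}) ?N"
    unfolding bij_betw_def using inj into onto by auto
  fix ka B assume "is_partition ka" "interl' ka la" "interl ka mu" and B: "B \<in> {0, 1 :: nat}"
  then have K: "ka i \<le> la i \<and> la i \<le> ka i + 1 \<and> ka i \<le> mu i \<and> mu (Suc i) \<le> ka i" for i
    using K_iff by blast
  obtain n where n: "\<And>i. n \<le> i \<Longrightarrow> la i = 0" "\<And>i. n \<le> i \<Longrightarrow> mu i = 0"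
    using common_zero_index[OF la mu] by blast
  have zero: "ka i = 0" "HV_insert la mu ka B i = 0" if "Suc n \<le> i" for i
    using K[of i] n(1)[of i] n(1)[of "i - 1"] n(2)[of i] that
    by (simp_all add: HV_insert_def HV_open_def)
  show "size_part (HV_insert la mu ka B) + size_part ka = size_part la + size_part mu + B"
    using HV_size_balance[OF K la, of B "Suc n"] n zero
      size_part_eq_sum[of "Suc n" la] size_part_eq_sum[of "Suc n" mu]
      size_part_eq_sum[of "Suc n" ka] size_part_eq_sum[of "Suc n" "HV_insert la mu ka B"]
    by (simp add: HV_open_def)
qed

section \<open>Sampling one box\<close>

fun is_up :: "letter \<Rightarrow> bool" where
  "is_up Prec = True" | "is_up Prec' = True" | "is_up _ = False"

text \<open>
  The constant \<open>C\<close> is \<open>1 - \<xi>\<close> for the geometric and \<open>1 / (1 + \<xi>)\<close> for the Bernoulli law. The set \<open>S\<close>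
  may be larger than the support of \<open>G\<close>: for \<open>\<xi> = 0\<close> only \<open>g = 0\<close> occurs.
\<close>

lemma sample_by_growth_rule:
  assumes "is_up u" "\<not> is_up d" "0 \<le> xi" "(u, d) \<in> {(Prec, Succ), (Prec', Succ')} \<Longrightarrow> xi < 1"
  obtains S F G C where "growth_rule (letter_rel u) (\<lambda>mu la. letter_rel d la mu) S F"
    "set_pmf G \<subseteq> S" "0 < C" "\<And>g. g \<in> S \<Longrightarrow> pmf G g = C * xi ^ g"
    "\<And>la mu ka. is_partition la \<Longrightarrow> is_partition mu \<Longrightarrow>
       sample u d la mu ka xi = map_pmf (F la mu ka) G"
proof -
  have geom: "pmf (Geom xi) g = (1 - xi) * xi ^ g" if "xi < 1" for g
    using assms(3) that by (simp add: Geom_def)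
  let ?G = "map_pmf of_bool (bernoulli_pmf (xi / (1 + xi))) :: nat pmf"
  have p: "0 \<le> xi / (1 + xi)" "xi / (1 + xi) \<le> 1" using assms(3) by auto
  have bern: "pmf ?G g = inverse (1 + xi) * xi ^ g" if "g \<in> {0, 1}" for g
  proof -
    have "pmf ?G (of_bool b) = pmf (bernoulli_pmf (xi / (1 + xi))) b" for b
      by (rule pmf_map_inj') (auto simp: inj_def)
    from this[of True] this[of False] that p assms(3) show ?thesis
      by (auto simp: field_simps)
  qed
  have ber: "set_pmf ?G \<subseteq> {0, 1}" "0 < inverse (1 + xi)"
    using assms(3) by (auto simp: image_iff)
  have HH: "sampleHH la mu ka xi = map_pmf (HH_insert la mu ka) (Geom xi)" for la mu ka
    unfolding sampleHH_def HH_insert_def ..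
  have up: "letter_rel Prec = interl" "letter_rel Prec' = interl'"
    by (simp_all add: fun_eq_iff)
  consider "u = Prec" "d = Succ" | "u = Prec'" "d = Succ'" | "u = Prec" "d = Succ'" | "u = Prec'" "d = Succ"
    using assms(1,2) by (cases u; cases d) auto
  then show ?thesis
  proof cases
    case 1
    with assms(4) geom HH growth_rule_HH show ?thesis
      by (intro that[of UNIV HH_insert "Geom xi" "1 - xi"]) (auto simp: up)
  next
    case 2
    have "growth_rule interl' interl' UNIV
        (\<lambda>la mu ka g. conj_part (HH_insert (conj_part la) (conj_part mu) (conj_part ka) g))"
      using growth_rule_conj[OF growth_rule_HH] unfolding interl'_def .
    with 2 assms(4) geom show ?thesis
      by (intro that[of UNIV _ "Geom xi" "1 - xi"]) (auto simp: up sampleVV_def HH pmf.map_comp comp_def)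
  next
    case 3
    with growth_rule_HV bern ber show ?thesis
      by (intro that[of "{0, 1}" HV_insert ?G "inverse (1 + xi)"]) (auto simp: up sampleHV_eq)
  next
    case 4
    with growth_rule_swap[OF growth_rule_HV] bern ber show ?thesis
      by (intro that[of "{0, 1}" _ ?G "inverse (1 + xi)"]) (auto simp: up sampleHV_eq sampleVH_def)
  qed
qed

section \<open>Exchanging two adjacent letters\<close>

lemma letter_rel_le:
  assumes "is_partition la" "is_partition mu" "letter_rel a la mu"
  shows "is_up a \<Longrightarrow> la i \<le> mu i" "\<not> is_up a \<Longrightarrow> mu i \<le> la i"
  using assms by (cases a; simp add: interl_def interl'_iff)+

lemma size_part_mono:
  assumes "is_partition la" "is_partition mu" "\<And>i. la i \<le> mu i"
  shows "size_part la \<le> size_part mu"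
proof -
  obtain n where "\<And>i. n \<le> i \<Longrightarrow> la i = 0" "\<And>i. n \<le> i \<Longrightarrow> mu i = 0"
    using common_zero_index[OF assms(1,2)] by blast
  then show ?thesis
    using size_part_eq_sum[of n la] size_part_eq_sum[of n mu] assms(3) by (simp add: sum_mono)
qed

text \<open>
  Injectivity is assumed on a set \<open>A\<close> that may exceed the support: when parameters vanish, the
  configurations form a larger set than those of positive probability.
\<close>

lemma pmf_map_inj_superset:
  assumes "inj_on f A" "set_pmf p \<subseteq> A" "x \<in> A"
  shows "pmf (map_pmf f p) (f x) = pmf p x"
proof -
  have "pmf (map_pmf f p) (f x) = measure (measure_pmf p) (f -` {f x} \<inter> set_pmf p)"
    by (simp add: pmf_map measure_Int_set_pmf)
  also have "f -` {f x} \<inter> set_pmf p = {x} \<inter> set_pmf p"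
    using assms by (auto dest: inj_onD)
  also have "measure (measure_pmf p) ({x} \<inter> set_pmf p) = pmf p x"
    by (simp add: measure_Int_set_pmf measure_pmf_single)
  finally show ?thesis .
qed

text \<open>
  The part of \<open>interlaced (p @ [a, b] @ s)\<close> that concerns neither \<open>a\<close> and \<open>b\<close> nor the entry
  between them, which is the only one to change at an exchange of \<open>a\<close> and \<open>b\<close>.
\<close>

definition outer_interlaced :: "letter list \<Rightarrow> letter list \<Rightarrow> seq list \<Rightarrow> bool" where
  "outer_interlaced p s L \<longleftrightarrow> length L = length p + length s + 3 \<and>
     (\<forall>i<length L. i \<noteq> Suc (length p) \<longrightarrow> is_partition (L ! i)) \<and>
     L ! 0 = empty_part \<and> L ! (length p + length s + 2) = empty_part \<and>
     (\<forall>i<length p. letter_rel (p ! i) (L ! i) (L ! Suc i)) \<and>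
     (\<forall>i<length s. letter_rel (s ! i) (L ! (length p + 2 + i)) (L ! Suc (length p + 2 + i)))"

lemma interlaced_split_iff:
  "interlaced (p @ [a, b] @ s) L \<longleftrightarrow> outer_interlaced p s L \<and>
     is_partition (L ! Suc (length p)) \<and>
     letter_rel a (L ! length p) (L ! Suc (length p)) \<and>
     letter_rel b (L ! Suc (length p)) (L ! Suc (Suc (length p)))"
proof -
  let ?k = "length p"
  have split: "(\<forall>i<?k + 2 + length s. P i) \<longleftrightarrow>
      (\<forall>i<?k. P i) \<and> P ?k \<and> P (Suc ?k) \<and> (\<forall>i<length s. P (?k + 2 + i))" for P
  proof (intro iffI conjI allI impI)
    fix i assume *: "(\<forall>i<?k. P i) \<and> P ?k \<and> P (Suc ?k) \<and> (\<forall>i<length s. P (?k + 2 + i))"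
      and i: "i < ?k + 2 + length s"
    consider "i < ?k" | "i = ?k" | "i = Suc ?k" | "i = ?k + 2 + (i - (?k + 2))" "i - (?k + 2) < length s"
      using i by linarith
    then show "P i" using * by cases metis+
  qed auto
  have part: "(\<forall>la\<in>set L. is_partition la) \<longleftrightarrow> is_partition (L ! Suc ?k) \<and>
      (\<forall>i<length L. i \<noteq> Suc ?k \<longrightarrow> is_partition (L ! i))" if "length L = ?k + length s + 3"
    using that by (auto simp: all_set_conv_all_nth)
  have len: "length (p @ [a, b] @ s) = ?k + 2 + length s" by simp
  have nths: "(p @ [a, b] @ s) ! ?k = a" "(p @ [a, b] @ s) ! Suc ?k = b"
    "(p @ [a, b] @ s) ! (?k + 2 + i) = s ! i" for i
    by (simp_all add: nth_append)
  have nthp: "(p @ [a, b] @ s) ! i = p ! i" if "i < ?k" for i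
    using that by (simp add: nth_append)
  show ?thesis
  proof (cases "length L = ?k + length s + 3")
    case True
    have "(\<forall>i<?k + 2 + length s. letter_rel ((p @ [a, b] @ s) ! i) (L ! i) (L ! Suc i)) \<longleftrightarrow>
      (\<forall>i<?k. letter_rel (p ! i) (L ! i) (L ! Suc i)) \<and> letter_rel a (L ! ?k) (L ! Suc ?k) \<and>
      letter_rel b (L ! Suc ?k) (L ! Suc (Suc ?k)) \<and>
      (\<forall>i<length s. letter_rel (s ! i) (L ! (?k + 2 + i)) (L ! Suc (?k + 2 + i)))"
      unfolding split nths using nthp by auto
    then show ?thesis
      unfolding interlaced_def outer_interlaced_def len part[OF True] using True
      by (auto simp: add.commute add.left_commute)
  next
    case False
    then show ?thesis by (auto simp: interlaced_def outer_interlaced_def)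
  qed
qed

lemma outer_interlaced_update [simp]:
  "outer_interlaced p s (L[Suc (length p) := ka]) \<longleftrightarrow> outer_interlaced p s L"
  by (auto simp: outer_interlaced_def nth_list_update)

definition step_size :: "seq list \<Rightarrow> nat \<Rightarrow> nat" where
  "step_size L i = nat \<bar>int (size_part (L ! Suc i)) - int (size_part (L ! i))\<bar>"

definition outer_weight :: "real list \<Rightarrow> real list \<Rightarrow> seq list \<Rightarrow> real" where
  "outer_weight p s L = (\<Prod>i<length p. (p ! i) ^ step_size L i) *
     (\<Prod>i<length s. (s ! i) ^ step_size L (length p + 2 + i))"

lemma prod_lessThan_add:
  fixes f :: "nat \<Rightarrow> 'a :: comm_monoid_mult"
  shows "prod f {..<m + n} = prod f {..<m} * (\<Prod>i<n. f (m + i))"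
  by (induction n) (simp_all add: mult.assoc)

lemma schur_weight_split:
  "schur_weight (p @ [x, y] @ s) L =
     outer_weight p s L * x ^ step_size L (length p) * y ^ step_size L (Suc (length p))"
proof -
  let ?f = "\<lambda>i. ((p @ [x, y] @ s) ! i) ^ step_size L i"
  have "schur_weight (p @ [x, y] @ s) L = prod ?f {..<length p + (2 + length s)}"
    by (simp add: schur_weight_def step_size_def)
  also have "\<dots> = prod ?f {..<length p} *
      ((\<Prod>i<2. ?f (length p + i)) * (\<Prod>i<length s. ?f (length p + (2 + i))))"
    by (simp only: prod_lessThan_add)
  also have "(\<Prod>i<2. ?f (length p + i)) = x ^ step_size L (length p) * y ^ step_size L (Suc (length p))"
    by (simp add: numeral_2_eq_2 nth_append)
  also have "(\<Prod>i<length s. ?f (length p + (2 + i))) = (\<Prod>i<length s. (s ! i) ^ step_size L (length p + 2 + i))"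
    by (simp add: nth_append)
  also have "prod ?f {..<length p} = (\<Prod>i<length p. (p ! i) ^ step_size L i)"
    by (simp add: nth_append)
  finally show ?thesis
    by (simp add: outer_weight_def mult_ac)
qed

lemma outer_weight_update [simp]:
  "outer_weight p s (L[Suc (length p) := ka]) = outer_weight p s L"
  by (simp add: outer_weight_def step_size_def nth_list_update)

definition resample_corner ::
  "letter \<Rightarrow> letter \<Rightarrow> real \<Rightarrow> nat \<Rightarrow> seq list \<Rightarrow> seq list pmf" where
  "resample_corner u d xi k L =
     map_pmf (\<lambda>nu. L[Suc k := nu]) (sample u d (L ! k) (L ! Suc (Suc k)) (L ! Suc k) xi)"

text \<open>
  Resampling pushes the product law of the sequence and of \<open>g\<close> forward along a map that the growth
  rule makes a bijection from all pairs onto the sequences interlaced for the new word. The size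
  identity says that both steps at the corner become longer by \<open>g\<close>, after changing places; so the
  weight gains the factor \<open>(x y)\<^sup>g\<close>, which is the probability of \<open>g\<close> up to a constant.
\<close>

lemma is_schur_process_exchange:
  assumes ud: "is_up u" "\<not> is_up d" and pos: "0 \<le> x" "0 \<le> y"
    and small: "(u, d) \<in> {(Prec, Succ), (Prec', Succ')} \<Longrightarrow> x * y < 1"
    and len: "length zp = length p"
    and q: "is_schur_process (p @ [d, u] @ s) (zp @ [y, x] @ zs) q"
  shows "is_schur_process (p @ [u, d] @ s) (zp @ [x, y] @ zs)
    (bind_pmf q (resample_corner u d (x * y) (length p)))"
proof -
  let ?k = "length p" and ?w' = "p @ [d, u] @ s" and ?w = "p @ [u, d] @ s"
  let ?z' = "zp @ [y, x] @ zs" and ?z = "zp @ [x, y] @ zs"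
  obtain c where c: "c > 0" "\<And>L. pmf q L = (if interlaced ?w' L then c * schur_weight ?z' L else 0)"
    using q unfolding is_schur_process_def by blast
  obtain S F G C where growth: "growth_rule (letter_rel u) (\<lambda>mu la. letter_rel d la mu) S F"
    and G: "set_pmf G \<subseteq> S" "0 < C" "\<And>g. g \<in> S \<Longrightarrow> pmf G g = C * (x * y) ^ g"
    and sample: "\<And>la mu ka. is_partition la \<Longrightarrow> is_partition mu \<Longrightarrow>
       sample u d la mu ka (x * y) = map_pmf (F la mu ka) G"
    using sample_by_growth_rule[OF ud, of "x * y"] pos small by (metis mult_nonneg_nonneg)
  let ?K = "\<lambda>la mu. {ka. is_partition ka \<and> letter_rel d la ka \<and> letter_rel u ka mu}"
  let ?N = "\<lambda>la mu. {nu. is_partition nu \<and> letter_rel u la nu \<and> letter_rel d nu mu}"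
  have bij: "bij_betw (\<lambda>(ka, g). F la mu ka g) (?K la mu \<times> S) (?N la mu)"
    if "is_partition la" "is_partition mu" for la mu
    using growth that unfolding growth_rule_def by blast
  have size: "size_part (F la mu ka g) + size_part ka = size_part la + size_part mu + g"
    if "is_partition la" "is_partition mu" "ka \<in> ?K la mu" "g \<in> S" for la mu ka g
    using growth that unfolding growth_rule_def by blast
  define \<Phi> where "\<Phi> = (\<lambda>(L, g). L[Suc ?k := F (L ! ?k) (L ! Suc (Suc ?k)) (L ! Suc ?k) g])"
  define A where "A = {L. interlaced ?w' L} \<times> S"
  have out: "length L = ?k + length s + 3 \<and> is_partition (L ! ?k) \<and> is_partition (L ! Suc (Suc ?k))"
    if "outer_interlaced p s L" for L
    using that by (auto simp: outer_interlaced_def)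
  have w'D: "outer_interlaced p s L \<and> L ! Suc ?k \<in> ?K (L ! ?k) (L ! Suc (Suc ?k))"
    if "interlaced ?w' L" for L
    using that unfolding interlaced_split_iff by simp
  have r: "bind_pmf q (resample_corner u d (x * y) ?k) = map_pmf \<Phi> (pair_pmf q G)"
  proof -
    have "resample_corner u d (x * y) ?k L = map_pmf (\<lambda>g. \<Phi> (L, g)) G" if "L \<in> set_pmf q" for L
    proof -
      from that c have "interlaced ?w' L" by (auto simp: set_pmf_iff split: if_splits)
      from w'D[OF this] out[of L] show ?thesis
        by (simp add: resample_corner_def sample \<Phi>_def pmf.map_comp comp_def)
    qed
    then have "bind_pmf q (resample_corner u d (x * y) ?k) =
        bind_pmf q (\<lambda>L. map_pmf (\<lambda>g. \<Phi> (L, g)) G)"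
      by (intro bind_pmf_cong) auto
    then show ?thesis
      by (simp add: pair_pmf_def map_bind_pmf map_pmf_def bind_assoc_pmf bind_return_pmf)
  qed
  have supp: "set_pmf (pair_pmf q G) \<subseteq> A"
    using c G(1) by (auto simp: A_def set_pmf_iff split: if_splits)
  have inj: "inj_on \<Phi> A"
  proof (rule inj_onI)
    fix a b assume ab: "a \<in> A" "b \<in> A" and eq: "\<Phi> a = \<Phi> b"
    obtain L g M h where a: "a = (L, g)" and b: "b = (M, h)" by (metis surj_pair)
    have L: "outer_interlaced p s L" "L ! Suc ?k \<in> ?K (L ! ?k) (L ! Suc (Suc ?k))" "g \<in> S"
      and M: "outer_interlaced p s M" "M ! Suc ?k \<in> ?K (M ! ?k) (M ! Suc (Suc ?k))" "h \<in> S"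
      using ab w'D by (auto simp: a b A_def)
    have len_eq: "length L = length M" and lenL: "Suc ?k < length L"
      using out[OF L(1)] out[OF M(1)] by auto
    have nth: "\<Phi> (L, g) ! i = \<Phi> (M, h) ! i" for i using eq by (simp add: a b)
    have same: "L ! i = M ! i" if "i \<noteq> Suc ?k" for i
      using nth[of i] that by (simp add: \<Phi>_def)
    let ?F = "\<lambda>(ka, g). F (L ! ?k) (L ! Suc (Suc ?k)) ka g"
    have "?F (L ! Suc ?k, g) = ?F (M ! Suc ?k, h)"
      using nth[of "Suc ?k"] same[of ?k] same[of "Suc (Suc ?k)"] lenL len_eq by (simp add: \<Phi>_def)
    moreover have "(L ! Suc ?k, g) \<in> ?K (L ! ?k) (L ! Suc (Suc ?k)) \<times> S"
      "(M ! Suc ?k, h) \<in> ?K (L ! ?k) (L ! Suc (Suc ?k)) \<times> S"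
      using L M same[of ?k] same[of "Suc (Suc ?k)"] by auto
    ultimately have "(L ! Suc ?k, g) = (M ! Suc ?k, h)"
      using bij[of "L ! ?k" "L ! Suc (Suc ?k)"] out[OF L(1)]
      by (meson bij_betw_imp_inj_on inj_onD)
    then have "L ! i = M ! i" "g = h" for i using same[of i] by (cases "i = Suc ?k"; simp)+
    then show "a = b" using len_eq by (simp add: a b nth_equalityI)
  qed
  have image: "\<Phi> ` A = {M. interlaced ?w M}"
  proof (intro equalityI subsetI)
    fix M assume "M \<in> \<Phi> ` A"
    then obtain L g where M: "M = \<Phi> (L, g)" and L: "interlaced ?w' L" and g: "g \<in> S"
      by (auto simp: A_def)
    let ?nu = "F (L ! ?k) (L ! Suc (Suc ?k)) (L ! Suc ?k) g"
    note L' = w'D[OF L]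
    have "?nu \<in> ?N (L ! ?k) (L ! Suc (Suc ?k))"
      using bij_betwE[OF bij[of "L ! ?k" "L ! Suc (Suc ?k)"]] out[of L] L' g by force
    then have "interlaced ?w M"
      unfolding interlaced_split_iff M \<Phi>_def using L' out[OF conjunct1[OF L']] by simp
    then show "M \<in> {M. interlaced ?w M}" by simp
  next
    fix M assume "M \<in> {M. interlaced ?w M}"
    then have M: "outer_interlaced p s M" "M ! Suc ?k \<in> ?N (M ! ?k) (M ! Suc (Suc ?k))"
      unfolding mem_Collect_eq interlaced_split_iff by simp_all
    from bij_betw_imp_surj_on[OF bij[of "M ! ?k" "M ! Suc (Suc ?k)"]] out[OF M(1)] M(2)
    obtain ka g where ka: "ka \<in> ?K (M ! ?k) (M ! Suc (Suc ?k))" "g \<in> S"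
      and nu: "M ! Suc ?k = F (M ! ?k) (M ! Suc (Suc ?k)) ka g"
      by (smt (verit, best) SigmaE case_prod_conv imageE)
    let ?L = "M[Suc ?k := ka]"
    have "interlaced ?w' ?L"
      unfolding interlaced_split_iff using ka out[OF M(1)] M(1) by simp
    moreover have "\<Phi> (?L, g) = M"
      using out[OF M(1)] by (simp add: \<Phi>_def nu[symmetric])
    ultimately show "M \<in> \<Phi> ` A" using ka(2) by (force simp: A_def)
  qed
  have weight: "pmf (pair_pmf q G) (L, g) = c * C * schur_weight ?z (\<Phi> (L, g))"
    if "(L, g) \<in> A" for L g
  proof -
    let ?la = "L ! ?k" and ?ka = "L ! Suc ?k" and ?mu = "L ! Suc (Suc ?k)"
    let ?M = "\<Phi> (L, g)"
    from that have L: "interlaced ?w' L" and g: "g \<in> S" by (auto simp: A_def)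
    have L': "outer_interlaced p s L" "?ka \<in> ?K ?la ?mu" using w'D[OF L] by auto
    note o = out[OF L'(1)]
    have "size_part ?ka \<le> size_part ?la" "size_part ?ka \<le> size_part ?mu"
      using L'(2) o letter_rel_le[of ?la ?ka d] letter_rel_le[of ?ka ?mu u] ud
      by (auto intro!: size_part_mono)
    moreover have M: "?M ! ?k = ?la" "?M ! Suc (Suc ?k) = ?mu" "?M ! Suc ?k = F ?la ?mu ?ka g"
      using o by (simp_all add: \<Phi>_def)
    moreover have "size_part (F ?la ?mu ?ka g) + size_part ?ka = size_part ?la + size_part ?mu + g"
      using size[OF _ _ L'(2) g] o by blast
    ultimately have steps: "step_size ?M ?k = step_size L (Suc ?k) + g"
      "step_size ?M (Suc ?k) = step_size L ?k + g"
      unfolding step_size_def M by linarith+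
    have "outer_weight zp zs ?M = outer_weight zp zs L"
      by (simp add: \<Phi>_def flip: len)
    then show ?thesis
      unfolding schur_weight_split len steps
      using L g by (simp only: pmf_pair c G schur_weight_split len if_True power_add power_mult_distrib)
        simp
  qed
  show ?thesis
    unfolding is_schur_process_def
  proof (intro exI conjI allI)
    show "0 < c * C" using c G by simp
    fix M show "pmf (bind_pmf q (resample_corner u d (x * y) ?k)) M =
        (if interlaced ?w M then c * C * schur_weight ?z M else 0)"
    proof (cases "interlaced ?w M")
      case True
      then have "M \<in> \<Phi> ` A" unfolding image by simp
      then obtain L g where Lg: "(L, g) \<in> A" "M = \<Phi> (L, g)" by (metis imageE surj_pair)
      have "pmf (map_pmf \<Phi> (pair_pmf q G)) M = pmf (pair_pmf q G) (L, g)"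
        unfolding Lg(2) by (rule pmf_map_inj_superset[OF inj supp Lg(1)])
      with True weight[OF Lg(1)] Lg(2) show ?thesis by (simp add: r)
    next
      case False
      then have "M \<notin> set_pmf (map_pmf \<Phi> (pair_pmf q G))"
        using image supp by auto
      then have "pmf (map_pmf \<Phi> (pair_pmf q G)) M = 0" by (simp only: set_pmf_iff not_not)
      with False show ?thesis by (simp add: r)
    qed
  qed
qed

section \<open>Words, boxes and boundary paths\<close>

lemma is_up_iff: "is_up a \<longleftrightarrow> a \<in> {Prec, Prec'}" "\<not> is_up a \<longleftrightarrow> a \<in> {Succ, Succ'}"
  by (cases a; simp)+

lemma up_positions_eq: "up_positions w = filter (\<lambda>k. is_up (w ! k)) [0..<length w]"
  by (simp add: up_positions_def is_up_iff(1))

lemma down_positions_eq: "down_positions w = rev (filter (\<lambda>k. \<not> is_up (w ! k)) [0..<length w])"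
  by (simp add: down_positions_def is_up_iff(2))

lemma filter_positions_append:
  "filter (\<lambda>k. P ((a @ b) ! k)) [0..<length (a @ b)] =
     filter (\<lambda>k. P (a ! k)) [0..<length a] @
     map (\<lambda>k. k + length a) (filter (\<lambda>k. P (b ! k)) [0..<length b])"
proof -
  have "[0..<length (a @ b)] = [0..<length a] @ map (\<lambda>k. k + length a) [0..<length b]"
    using upt_add_eq_append[of 0 "length a" "length b"] map_add_upt[of "length a" "length b"]
    by (simp add: add.commute)
  then show ?thesis
    by (simp only: filter_append filter_map) (auto simp: comp_def nth_append intro!: filter_cong)
qed

lemma up_positions_append:
  "up_positions (a @ b) = up_positions a @ map (\<lambda>k. k + length a) (up_positions b)"
  unfolding up_positions_eq by (rule filter_positions_append)

lemma down_positions_append: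
  "down_positions (a @ b) = map (\<lambda>k. k + length a) (down_positions b) @ down_positions a"
  unfolding down_positions_eq filter_positions_append[where P = "\<lambda>a. \<not> is_up a"]
  by (simp add: rev_map)

lemma map_nth_positions:
  "map ((!) xs) (filter (\<lambda>k. P (xs ! k)) [0..<length xs]) = filter P xs"
  using filter_map[of P "(!) xs" "[0..<length xs]"] by (simp add: map_nth comp_def)

text \<open>
  The letters and parameters used by the boxes depend on the word only through its ascending
  subword and its descending subword, neither of which changes at an exchange.
\<close>

lemma up_data_eq:
  assumes "length z = length w"
  shows "map (\<lambda>k. (z ! k, w ! k)) (up_positions w) = filter (\<lambda>a. is_up (snd a)) (zip z w)"
    "map (\<lambda>k. (z ! k, w ! k)) (down_positions w) = rev (filter (\<lambda>a. \<not> is_up (snd a)) (zip z w))"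
proof -
  have "map (\<lambda>k. (z ! k, w ! k)) (filter (\<lambda>k. P (w ! k)) [0..<length w]) =
      filter (\<lambda>a. P (snd a)) (zip z w)" for P
    by (subst map_nth_positions[of "zip z w", symmetric])
       (auto simp: assms intro!: map_cong filter_cong)
  then show "map (\<lambda>k. (z ! k, w ! k)) (up_positions w) = filter (\<lambda>a. is_up (snd a)) (zip z w)"
    "map (\<lambda>k. (z ! k, w ! k)) (down_positions w) = rev (filter (\<lambda>a. \<not> is_up (snd a)) (zip z w))"
    by (simp_all add: up_positions_eq down_positions_eq rev_map[symmetric])
qed

lemma length_up_positions: "length (up_positions w) = length (filter is_up w)"
  unfolding up_positions_eq using arg_cong[OF map_nth_positions[of w is_up], of length] by simp

lemma length_down_positions: "length (down_positions w) = length (filter (\<lambda>a. \<not> is_up a) w)"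
  unfolding down_positions_eq
  using arg_cong[OF map_nth_positions[of w "\<lambda>a. \<not> is_up a"], of length] by simp

lemma sorted_up_positions: "sorted_wrt (<) (up_positions w)"
  unfolding up_positions_eq by (intro sorted_wrt_filter) (simp add: strict_sorted_iff)

lemma sorted_down_positions: "sorted_wrt (>) (down_positions w)"
  unfolding down_positions_eq sorted_wrt_rev by (intro sorted_wrt_filter) (simp add: strict_sorted_iff)

lemma up_positions_less_iff:
  "i < length (up_positions w) \<Longrightarrow> j < length (up_positions w) \<Longrightarrow>
    up_positions w ! i < up_positions w ! j \<longleftrightarrow> i < j"
  using sorted_wrt_nth_less[OF sorted_up_positions, of i j w]
    sorted_wrt_nth_less[OF sorted_up_positions, of j i w]
  by (cases i j rule: linorder_cases) auto

lemma down_positions_less_iff: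
  "i < length (down_positions w) \<Longrightarrow> j < length (down_positions w) \<Longrightarrow>
    down_positions w ! j < down_positions w ! i \<longleftrightarrow> i < j"
  using sorted_wrt_nth_less[OF sorted_down_positions, of i j w]
    sorted_wrt_nth_less[OF sorted_down_positions, of j i w]
  by (cases i j rule: linorder_cases) auto

lemma set_up_positions: "set (up_positions w) = {k. k < length w \<and> is_up (w ! k)}"
  by (auto simp: up_positions_eq)

lemma set_down_positions: "set (down_positions w) = {k. k < length w \<and> \<not> is_up (w ! k)}"
  by (auto simp: down_positions_eq)

lemma less_card_filter_iff:
  fixes xs :: "nat list"
  assumes "sorted_wrt (<) xs"
  shows "t < card {k \<in> set xs. k < q} \<longleftrightarrow> t < length xs \<and> xs ! t < q"
proof -
  let ?T = "{t. t < length xs \<and> xs ! t < q}"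
  have "inj_on ((!) xs) ?T"
    using assms by (intro inj_on_nth) (auto simp: strict_sorted_iff)
  moreover have "{k \<in> set xs. k < q} = (!) xs ` ?T"
    by (auto simp: in_set_conv_nth)
  ultimately have card: "card {k \<in> set xs. k < q} = card ?T"
    by (simp add: card_image)
  have "?T = {..<card ?T}"
  proof (rule finite_down_closed_eq)
    fix s t assume t: "t \<in> ?T" and "s \<le> t"
    then have "xs ! s \<le> xs ! t"
      using sorted_wrt_nth_less[OF assms, of s t] by (cases "s = t") auto
    with t \<open>s \<le> t\<close> show "s \<in> ?T" by auto
  qed simp
  from eqset_imp_iff[OF this, of t] show ?thesis unfolding card by simp
qed

lemma sh_eq:
  "sh w j = (if j < length (down_positions w) then card {k \<in> set (up_positions w). k < down_positions w ! j} else 0)"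
proof (cases "j < length (down_positions w)")
  case True
  then have "down_positions w ! j < length w"
    using nth_mem[OF True] by (auto simp: set_down_positions)
  then have "{k. k < down_positions w ! j \<and> w ! k \<in> {Prec, Prec'}} =
      {k \<in> set (up_positions w). k < down_positions w ! j}"
    unfolding set_up_positions is_up_iff by auto
  with True show ?thesis by (simp add: sh_def)
qed (simp add: sh_def)

lemma is_partition_sh: "is_partition (sh w)"
proof -
  have "sh w (Suc j) \<le> sh w j" for j
    using sorted_wrt_nth_less[OF sorted_down_positions, of j "Suc j" w]
    by (auto simp: sh_eq intro!: card_mono)
  moreover have "{j. sh w j \<noteq> 0} \<subseteq> {..<length (down_positions w)}"
    by (auto simp: sh_eq split: if_splits)
  ultimately show ?thesis
    unfolding is_partition_def using finite_subset finite_lessThan by blast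
qed

text \<open>
  Boxes correspond to the inversions of the word: pairs of an ascending letter and a descending
  letter to the right of it.
\<close>

lemma Suc_Suc_boxes_iff:
  "(Suc i, Suc j) \<in> boxes w \<longleftrightarrow> i < length (up_positions w) \<and> j < length (down_positions w) \<and>
     up_positions w ! i < down_positions w ! j"
proof -
  have "(Suc i, Suc j) \<in> boxes w \<longleftrightarrow> i < sh w j"
    using part_nonzero_iff_less_len[OF is_partition_sh, of w j]
    by (auto simp: boxes_def Suc_le_eq)
  then show ?thesis
    by (auto simp: sh_eq less_card_filter_iff[OF sorted_up_positions])
qed

lemma boxesE:
  assumes "b \<in> boxes w"
  obtains i j where "b = (Suc i, Suc j)" "i < length (up_positions w)" "j < length (down_positions w)"
    "up_positions w ! i < down_positions w ! j"
proof -
  from assms obtain i j where "b = (Suc i, Suc j)"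
    by (auto simp: boxes_def Suc_le_eq gr0_conv_Suc)
  with assms that show ?thesis by (simp add: Suc_Suc_boxes_iff)
qed

lemma up_before_down_box:
  assumes "k < l" "l < length w" "is_up (w ! k)" "\<not> is_up (w ! l)"
  obtains i j where "i < length (up_positions w)" "up_positions w ! i = k"
    "j < length (down_positions w)" "down_positions w ! j = l" "(Suc i, Suc j) \<in> boxes w"
proof -
  from assms have "k \<in> set (up_positions w)" "l \<in> set (down_positions w)"
    by (auto simp: set_up_positions set_down_positions)
  then obtain i j where "i < length (up_positions w)" "up_positions w ! i = k"
    "j < length (down_positions w)" "down_positions w ! j = l"
    by (auto simp: in_set_conv_nth)
  with that assms(1) show ?thesis by (simp add: Suc_Suc_boxes_iff)
qed

lemma positions_corner:
  assumes "is_up u" "\<not> is_up d"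
  shows "up_positions (p @ [u, d] @ s) =
      up_positions p @ [length p] @ map (\<lambda>k. k + 2 + length p) (up_positions s)"
    "down_positions (p @ [u, d] @ s) =
      map (\<lambda>k. k + 2 + length p) (down_positions s) @ [Suc (length p)] @ down_positions p"
    "up_positions (p @ [d, u] @ s) =
      up_positions p @ [Suc (length p)] @ map (\<lambda>k. k + 2 + length p) (up_positions s)"
    "down_positions (p @ [d, u] @ s) =
      map (\<lambda>k. k + 2 + length p) (down_positions s) @ [length p] @ down_positions p"
proof -
  have "up_positions [u, d] = [0]" "down_positions [u, d] = [1]"
    "up_positions [d, u] = [1]" "down_positions [d, u] = [0]"
    using assms by (simp_all add: up_positions_eq down_positions_eq)
  then show "up_positions (p @ [u, d] @ s) =
      up_positions p @ [length p] @ map (\<lambda>k. k + 2 + length p) (up_positions s)"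
    "down_positions (p @ [u, d] @ s) =
      map (\<lambda>k. k + 2 + length p) (down_positions s) @ [Suc (length p)] @ down_positions p"
    "up_positions (p @ [d, u] @ s) =
      up_positions p @ [Suc (length p)] @ map (\<lambda>k. k + 2 + length p) (up_positions s)"
    "down_positions (p @ [d, u] @ s) =
      map (\<lambda>k. k + 2 + length p) (down_positions s) @ [length p] @ down_positions p"
    unfolding up_positions_append down_positions_append by (simp_all add: comp_def)
qed

lemma boxes_exchange:
  assumes ud: "is_up u" "\<not> is_up d"
  shows "boxes (p @ [d, u] @ s) =
    boxes (p @ [u, d] @ s) - {(Suc (length (up_positions p)), Suc (length (down_positions s)))}"
proof -
  let ?w = "p @ [u, d] @ s" and ?w' = "p @ [d, u] @ s"
  let ?a = "length (up_positions p)" and ?e = "length (down_positions s)"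
  note pos = positions_corner[OF ud, of p s]
  have len: "length (up_positions ?w') = length (up_positions ?w)"
    "length (down_positions ?w') = length (down_positions ?w)" unfolding pos by simp_all
  have p: "i < ?a \<Longrightarrow> up_positions p ! i < length p"
    "?e < j \<Longrightarrow> j < Suc (?e + length (down_positions p)) \<Longrightarrow>
      down_positions p ! (j - Suc ?e) < length p" for i j
    using nth_mem[of i "up_positions p"] nth_mem[of "j - Suc ?e" "down_positions p"]
    by (auto simp: set_up_positions set_down_positions)
  have up: "if i = ?a then up_positions ?w ! i = length p \<and> up_positions ?w' ! i = Suc (length p)
      else up_positions ?w' ! i = up_positions ?w ! i \<and>
        up_positions ?w ! i \<noteq> length p \<and> up_positions ?w ! i \<noteq> Suc (length p)"
    if "i < length (up_positions ?w)" for i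
    using that p(1)[of i] unfolding pos by (auto simp: nth_append nth_Cons')
  have down: "if j = ?e then down_positions ?w ! j = Suc (length p) \<and> down_positions ?w' ! j = length p
      else down_positions ?w' ! j = down_positions ?w ! j \<and>
        down_positions ?w ! j \<noteq> length p \<and> down_positions ?w ! j \<noteq> Suc (length p)"
    if "j < length (down_positions ?w)" for j
    using that p(2)[of j] unfolding pos by (auto simp: nth_append nth_Cons')
  have iff: "(Suc i, Suc j) \<in> boxes ?w' \<longleftrightarrow> (Suc i, Suc j) \<in> boxes ?w \<and> (i, j) \<noteq> (?a, ?e)" for i j
  proof (cases "i < length (up_positions ?w) \<and> j < length (down_positions ?w)")
    case True
    with up[of i] down[of j] show ?thesis
      unfolding Suc_Suc_boxes_iff len by (auto split: if_splits)
  next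
    case False
    then show ?thesis unfolding Suc_Suc_boxes_iff len by auto
  qed
  show ?thesis
  proof (intro set_eqI)
    fix b
    show "b \<in> boxes ?w' \<longleftrightarrow> b \<in> boxes ?w - {(Suc ?a, Suc ?e)}"
    proof (cases "\<exists>i j. b = (Suc i, Suc j)")
      case True
      then obtain i j where "b = (Suc i, Suc j)" by blast
      with iff[of i j] show ?thesis by simp
    next
      case False
      then have "b \<notin> boxes v" for v by (blast elim: boxesE)
      then show ?thesis by blast
    qed
  qed
qed

text \<open>
  If some letter stood strictly between the two letters of the box, it would form, together with
  one of them, a box that exceeds \<open>b\<close> in one coordinate, against maximality.
\<close>

lemma corner_decomposition:
  assumes b: "b \<in> boxes w"
    and maximal: "\<forall>c\<in>boxes w. fst b \<le> fst c \<and> snd b \<le> snd c \<longrightarrow> c = b"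
  obtains p u d s where "w = p @ [u, d] @ s" "is_up u" "\<not> is_up d"
    "b = (Suc (length (up_positions p)), Suc (length (down_positions s)))"
proof -
  obtain i j where bij: "b = (Suc i, Suc j)" and i: "i < length (up_positions w)"
    and j: "j < length (down_positions w)" and lt: "up_positions w ! i < down_positions w ! j"
    using b by (rule boxesE)
  let ?P = "up_positions w ! i" and ?Q = "down_positions w ! j"
  have P: "is_up (w ! ?P)" and Q: "?Q < length w" "\<not> is_up (w ! ?Q)"
    using nth_mem[OF i] nth_mem[OF j] by (auto simp: set_up_positions set_down_positions)
  have "?Q = Suc ?P"
  proof (rule ccontr)
    assume "?Q \<noteq> Suc ?P"
    with lt have between: "Suc ?P < ?Q" by simp
    show False
    proof (cases "is_up (w ! Suc ?P)")
      case True
      obtain i' j' where i': "i' < length (up_positions w)" "up_positions w ! i' = Suc ?P"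
        and "j' < length (down_positions w)" "down_positions w ! j' = ?Q" "(Suc i', Suc j') \<in> boxes w"
        by (rule up_before_down_box[OF between Q(1) True Q(2)])
      have "i < i'" using up_positions_less_iff[OF i i'(1)] i'(2) by simp
      moreover have "(Suc i', Suc j) \<in> boxes w"
        using i' j between by (simp add: Suc_Suc_boxes_iff)
      ultimately show False using bspec[OF maximal, of "(Suc i', Suc j)"] by (simp add: bij)
    next
      case False
      have "?P < Suc ?P" "Suc ?P < length w" using between Q(1) by auto
      from up_before_down_box[OF this P False]
      obtain i' j' where "i' < length (up_positions w)" "up_positions w ! i' = ?P"
        and j': "j' < length (down_positions w)" "down_positions w ! j' = Suc ?P"
        and "(Suc i', Suc j') \<in> boxes w" .
      have "j < j'" using down_positions_less_iff[OF j j'(1)] j'(2) between by simp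
      moreover have "(Suc i, Suc j') \<in> boxes w"
        using i j' by (simp add: Suc_Suc_boxes_iff)
      ultimately show False using bspec[OF maximal, of "(Suc i, Suc j')"] by (simp add: bij)
    qed
  qed
  define p s where "p = take ?P w" and "s = drop (Suc (Suc ?P)) w"
  have w: "w = p @ [w ! ?P, w ! ?Q] @ s"
    using Q(1) \<open>?Q = Suc ?P\<close> id_take_nth_drop[of ?P w] Cons_nth_drop_Suc[of "Suc ?P" w, symmetric]
    unfolding p_def s_def by simp
  have lenp: "length p = ?P" using Q(1) lt by (simp add: p_def)
  note pos = positions_corner(1,2)[OF P Q(2), of p s, folded w]
  have middle: "xs ! length as = k \<and> length as < length xs" if "xs = as @ [k] @ cs"
    for xs as cs :: "nat list" and k using that by simp
  have "up_positions w ! length (up_positions p) = ?P"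
    "length (up_positions p) < length (up_positions w)"
    using middle[OF pos(1)] lenp by simp_all
  then have "i = length (up_positions p)"
    using i up_positions_less_iff[of i w "length (up_positions p)"]
      up_positions_less_iff[of "length (up_positions p)" w i]
    by (metis linorder_neqE_nat order.irrefl)
  moreover have "down_positions w ! length (down_positions s) = ?Q"
    "length (down_positions s) < length (down_positions w)"
    using middle[OF pos(2)] lenp \<open>?Q = Suc ?P\<close> by simp_all
  then have "j = length (down_positions s)"
    using j down_positions_less_iff[of j w "length (down_positions s)"]
      down_positions_less_iff[of "length (down_positions s)" w j]
    by (metis linorder_neqE_nat order.irrefl)
  ultimately show ?thesis using that[OF w P Q(2)] bij by simp
qed

lemma length_lattice_path [simp]: "length (lattice_path w l) = Suc (length w)"
  by (induction w arbitrary: l) auto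

lemma nth_lattice_path:
  "t \<le> length w \<Longrightarrow> lattice_path w l ! t =
     (fst l + length (up_positions (take t w)), snd l - length (down_positions (take t w)))"
proof (induction w arbitrary: l t)
  case Nil then show ?case by (simp add: up_positions_def down_positions_def)
next
  case (Cons a w)
  show ?case
  proof (cases t)
    case 0 then show ?thesis by (simp add: up_positions_def down_positions_def)
  next
    case (Suc t')
    with Cons.prems Cons.IH[of t'] show ?thesis
      by (cases a) (simp_all add: length_up_positions length_down_positions)
  qed
qed

section \<open>The algorithm along an admissible order\<close>

lemma sample_boxes_append:
  "sample_boxes w z (bs @ cs) = (\<lambda>tau. bind_pmf (sample_boxes w z bs tau) (sample_boxes w z cs))"
  by (induction bs) (auto simp: bind_return_pmf bind_assoc_pmf)

lemma sample_boxes_cong: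
  assumes "\<And>b. b \<in> set bs \<Longrightarrow> sample_box w z b = sample_box w' z' b"
  shows "sample_boxes w z bs = sample_boxes w' z' bs"
  using assms
proof (induction bs)
  case (Cons b bs)
  then have "sample_boxes w z bs = sample_boxes w' z' bs" by simp
  with Cons.prems[of b] show ?case by (intro ext) simp
qed (simp add: fun_eq_iff)

lemma sample_box_exchange:
  assumes ud: "is_up u" "\<not> is_up d" and len: "length zp = length p" "length zs = length s"
    and b: "b \<in> boxes (p @ [u, d] @ s)"
  shows "sample_box (p @ [u, d] @ s) (zp @ [x, y] @ zs) b =
    sample_box (p @ [d, u] @ s) (zp @ [y, x] @ zs) b"
proof -
  let ?w = "p @ [u, d] @ s" and ?w' = "p @ [d, u] @ s"
  let ?z = "zp @ [x, y] @ zs" and ?z' = "zp @ [y, x] @ zs"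
  let ?D = "\<lambda>w z. \<lambda>k. (z ! k, w ! k)"
  obtain i j where b: "b = (Suc i, Suc j)" "i < length (up_positions ?w)" "j < length (down_positions ?w)"
    using b by (rule boxesE)
  have lens: "length ?z = length ?w" "length ?z' = length ?w'" using len by simp_all
  have "map (?D ?w ?z) (up_positions ?w) = map (?D ?w' ?z') (up_positions ?w')"
    "map (?D ?w ?z) (down_positions ?w) = map (?D ?w' ?z') (down_positions ?w')"
    unfolding up_data_eq[OF lens(1)] up_data_eq[OF lens(2)] using len ud by simp_all
  from arg_cong[OF this(1), of "\<lambda>xs. (length xs, xs ! i)"] arg_cong[OF this(2), of "\<lambda>xs. (length xs, xs ! j)"]
  have "x_param ?w ?z (Suc i) = x_param ?w' ?z' (Suc i)" "u_letter ?w (Suc i) = u_letter ?w' (Suc i)"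
    "y_param ?w ?z (Suc j) = y_param ?w' ?z' (Suc j)" "v_letter ?w (Suc j) = v_letter ?w' (Suc j)"
    using b(2,3) unfolding x_param_def u_letter_def y_param_def v_letter_def by (simp_all del: append.simps)
  then show ?thesis by (simp only: sample_box_def b(1) prod.case)
qed

text \<open>
  The boundary paths of the two words differ only in the point \<open>b\<close>, which replaces its opposite
  corner. So the table matters only through its values along the old path, and overwriting the table
  at \<open>b\<close> is an update of one list entry.
\<close>

lemma SchurSample_along_snoc:
  fixes p s :: "letter list" and u d :: letter
  defines "w \<equiv> p @ [u, d] @ s" and "w' \<equiv> p @ [d, u] @ s"
  assumes ud: "is_up u" "\<not> is_up d" and len: "length zp = length p" "length zs = length s"
    and bs: "set bs \<subseteq> boxes w"
    and b: "b = (Suc (length (up_positions p)), Suc (length (down_positions s)))"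
  shows "SchurSample_along (bs @ [b]) w (zp @ [x, y] @ zs) =
    bind_pmf (SchurSample_along bs w' (zp @ [y, x] @ zs)) (resample_corner u d (x * y) (length p))"
proof -
  let ?z = "zp @ [x, y] @ zs" and ?z' = "zp @ [y, x] @ zs"
  let ?k = "length p" and ?a = "length (up_positions p)" and ?e = "length (down_positions s)"
  note pos = positions_corner[OF ud, of p s, folded w_def w'_def]
  define n where "n = length (down_positions w)"
  have n: "n = length (down_positions p) + Suc ?e" and n': "n = length (down_positions w')"
    unfolding n_def pos by simp_all
  define path path' where "path = lattice_path w (0, n)" and "path' = lattice_path w' (0, n)"
  have len_path: "length path = ?k + length s + 3" "length path' = ?k + length s + 3"
    by (simp_all add: path_def path'_def w_def w'_def)
  have nth_path: "path ! t = (length (up_positions (take t w)), n - length (down_positions (take t w)))"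
    "path' ! t = (length (up_positions (take t w')), n - length (down_positions (take t w')))"
    if "t < ?k + length s + 3" for t
    using that by (simp_all add: path_def path'_def nth_lattice_path w_def w'_def)
  have corner: "path' ! ?k = (?a, Suc ?e)" "path' ! Suc ?k = (?a, ?e)" "path' ! Suc (Suc ?k) = (Suc ?a, ?e)"
    "path ! Suc ?k = b"
    using ud unfolding b
    by (simp_all add: nth_path w_def w'_def length_up_positions length_down_positions n)
  \<comment> \<open>The two coordinates determine how many letters have been read, hence \<open>t\<close>.\<close>
  have other: "path ! t = path' ! t \<and> path' ! t \<noteq> b"
    if t: "t < ?k + length s + 3" "t \<noteq> Suc ?k" for t
  proof -
    have up: "length (up_positions (take t v)) = length (filter is_up (take t v))"
      and down: "length (down_positions (take t v)) + length (filter is_up (take t v)) = min t (length v)"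
      for v
      using sum_length_filter_compl[of is_up "take t v"]
      by (simp_all add: length_up_positions length_down_positions min.commute)
    have eq: "length (filter is_up (take t w)) = length (filter is_up (take t w'))"
    proof (cases "t \<le> ?k")
      case False
      then have "Suc (Suc ?k) \<le> t" using t(2) by linarith
      then obtain r where "t = Suc (Suc (?k + r))"
        using le_Suc_ex[of "Suc (Suc ?k)" t] by auto
      then show ?thesis by (simp add: w_def w'_def)
    qed (simp add: w_def w'_def)
    have lw: "length w = length w'" "t \<le> length w'" using t(1) by (simp_all add: w_def w'_def)
    have "path ! t = path' ! t"
      using eq down[of w] down[of w'] lw unfolding nth_path[OF t(1)] up by simp
    moreover have "path' ! t \<noteq> b"
    proof
      assume "path' ! t = b"
      then have "length (filter is_up (take t w')) = Suc ?a"
        "n - length (down_positions (take t w')) = Suc ?e"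
        unfolding nth_path[OF t(1)] up b by simp_all
      with down[of w'] lw n have "t = Suc ?a + length (down_positions p)" by linarith
      moreover have "?a + length (down_positions p) = ?k"
        using sum_length_filter_compl[of is_up p] by (simp add: length_up_positions length_down_positions)
      ultimately show False using t(2) by simp
    qed
    ultimately show ?thesis by blast
  qed
  have update: "map (tau(b := nu)) path = (map tau path')[Suc ?k := nu]" for tau :: table and nu
  proof (rule nth_equalityI)
    fix t assume "t < length (map (tau(b := nu)) path)"
    then have "t < ?k + length s + 3" by (simp add: len_path)
    with other[of t] corner(4) show "map (tau(b := nu)) path ! t = (map tau path')[Suc ?k := nu] ! t"
      by (cases "t = Suc ?k") (simp_all add: len_path)
  qed (simp add: len_path)
  have params: "u_letter w (Suc ?a) = u" "v_letter w (Suc ?e) = d" "x_param w ?z (Suc ?a) = x"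
    "y_param w ?z (Suc ?e) = y"
    unfolding u_letter_def v_letter_def x_param_def y_param_def pos
    using len by (simp_all add: nth_append w_def)
  have step: "map_pmf (\<lambda>tau. map tau path) (sample_box w ?z b tau) =
      resample_corner u d (x * y) ?k (map tau path')" for tau
    unfolding resample_corner_def update[symmetric]
    by (simp add: b sample_box_def params pmf.map_comp comp_def corner len_path del: append.simps)
  have sample_one: "sample_boxes w ?z [b] = sample_box w ?z b"
  proof
    fix tau
    have "sample_boxes w ?z [] = return_pmf" by (intro ext) simp
    then show "sample_boxes w ?z [b] tau = sample_box w ?z b tau"
      by (simp only: sample_boxes.simps(2) bind_return_pmf')
  qed
  have "sample_boxes w ?z bs = sample_boxes w' ?z' bs"
    using bs sample_box_exchange[OF ud len] unfolding w_def w'_def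
    by (intro sample_boxes_cong) blast
  then show ?thesis
    unfolding SchurSample_along_def n_def[symmetric] n'[symmetric] path_def[symmetric] path'_def[symmetric]
    by (simp only: sample_boxes_append sample_one map_bind_pmf bind_map_pmf step)
qed

lemma up_before_no_down:
  assumes "boxes w = {}" "k < t" "k < length w" "is_up (w ! k)" "t \<le> l" "l < length w"
  shows "is_up (w ! l)"
proof (rule ccontr)
  assume "\<not> is_up (w ! l)"
  from up_before_down_box[OF _ assms(6,4) this] assms show False by auto
qed

lemma is_partition_empty: "is_partition empty_part"
  by (simp add: is_partition_def empty_part_def)

lemma letter_rel_empty: "letter_rel a empty_part empty_part"
proof -
  have "interl' empty_part empty_part"
    by (simp add: interl'_iff is_partition_empty)
  moreover have "interl empty_part empty_part"
    by (simp add: interl_def empty_part_def)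
  ultimately show ?thesis by (cases a) simp_all
qed

lemma eq_empty_partI: "(\<And>i. la i \<le> empty_part i) \<Longrightarrow> la = empty_part"
  by (auto simp: empty_part_def fun_eq_iff)

text \<open>
  All descending letters precede all ascending ones: the sequence decreases from the empty
  partition and then increases to the empty partition.
\<close>

lemma interlaced_no_boxes_iff:
  assumes "boxes w = {}"
  shows "interlaced w L \<longleftrightarrow> L = replicate (length w + 1) empty_part"
proof
  assume "L = replicate (length w + 1) empty_part"
  then show "interlaced w L"
    by (simp add: interlaced_def is_partition_empty letter_rel_empty del: replicate.simps)
next
  assume L: "interlaced w L"
  have part: "is_partition (L ! t)" if "t \<le> length w" for t
    using L that by (auto simp: interlaced_def)
  have rel: "letter_rel (w ! t) (L ! t) (L ! Suc t)" if "t < length w" for t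
    using L that by (simp add: interlaced_def)
  have ends: "L ! 0 = empty_part" "L ! length w = empty_part" "length L = length w + 1"
    using L by (simp_all add: interlaced_def)
  have "L ! t = empty_part" if t: "t \<le> length w" for t
  proof (cases "\<exists>k<t. is_up (w ! k)")
    case True
    then have up: "is_up (w ! l)" if "t \<le> l" "l < length w" for l
      using up_before_no_down[OF assms] that by (metis order.strict_trans2 order.strict_trans)
    show ?thesis using t
    proof (induction rule: inc_induct)
      case (step l)
      then show ?case
        using letter_rel_le(1)[OF part part rel up, of l] by (intro eq_empty_partI) simp
    qed (rule ends)
  next
    case False
    have "l \<le> t \<longrightarrow> L ! l = empty_part" for l
    proof (induction l)
      case (Suc l)
      then show ?case
        using letter_rel_le(2)[OF part part rel, of l] False t by (auto intro!: eq_empty_partI)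
    qed (simp add: ends)
    then show ?thesis by blast
  qed
  then show "L = replicate (length w + 1) empty_part"
    by (intro nth_equalityI) (auto simp: ends nth_Cons' simp del: replicate.simps)
qed

lemma is_schur_process_no_boxes:
  assumes "boxes w = {}" and len: "length z = length w"
  shows "is_schur_process w z (SchurSample_along [] w z)"
proof -
  let ?E = "replicate (length w + 1) empty_part"
  let ?n = "length (down_positions w)"
  have "map init_table (lattice_path w (0, ?n)) = ?E"
  proof (rule nth_equalityI)
    fix t assume "t < length (map init_table (lattice_path w (0, ?n)))"
    then have t: "t \<le> length w" by simp
    have "length (up_positions (take t w)) = 0 \<or> ?n - length (down_positions (take t w)) = 0"
    proof (cases "\<exists>k<t. is_up (w ! k)")
      case True
      then have up: "is_up (w ! l)" if "t \<le> l" "l < length w" for l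
        using up_before_no_down[OF assms(1)] that by (metis order.strict_trans2 order.strict_trans)
      have "is_up a" if "a \<in> set (drop t w)" for a
        using that up[of "t + _"] by (auto simp: in_set_conv_nth)
      then have "filter (\<lambda>a. \<not> is_up a) (drop t w) = []" by (simp add: filter_empty_conv)
      then have "length (filter (\<lambda>a. \<not> is_up a) (take t w @ drop t w)) = length (filter (\<lambda>a. \<not> is_up a) (take t w))"
        unfolding filter_append by simp
      then show ?thesis by (simp add: length_down_positions)
    next
      case False
      then show ?thesis
        by (auto simp: length_up_positions filter_empty_conv in_set_conv_nth)
    qed
    then show "map init_table (lattice_path w (0, ?n)) ! t = ?E ! t"
      using t by (auto simp: nth_lattice_path init_table_def nth_Cons' simp del: replicate.simps)
  qed simp
  moreover have "schur_weight z ?E = 1"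
  proof -
    have "?E ! t = empty_part" if "t \<le> length w" for t
      using that by (simp del: replicate.simps)
    then show ?thesis by (simp add: schur_weight_def len del: replicate.simps)
  qed
  ultimately show ?thesis
    unfolding is_schur_process_def SchurSample_along_def interlaced_no_boxes_iff[OF assms(1)]
    by (intro exI[of _ 1]) (auto simp: pmf_return simp del: replicate.simps)
qed

lemma admissible_order_snoc:
  assumes "admissible_order w (bs @ [b])"
  shows "b \<in> boxes w" "set bs = boxes w - {b}"
    "\<forall>c\<in>boxes w. fst b \<le> fst c \<and> snd b \<le> snd c \<longrightarrow> c = b"
    "boxes w' = boxes w - {b} \<Longrightarrow> admissible_order w' bs"
proof -
  have set: "set (bs @ [b]) = boxes w" and dist: "distinct (bs @ [b])"
    and order: "\<And>m n. m < length (bs @ [b]) \<Longrightarrow> n < length (bs @ [b]) \<Longrightarrow>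
      (bs @ [b]) ! m \<noteq> (bs @ [b]) ! n \<Longrightarrow> fst ((bs @ [b]) ! m) \<le> fst ((bs @ [b]) ! n) \<Longrightarrow>
      snd ((bs @ [b]) ! m) \<le> snd ((bs @ [b]) ! n) \<Longrightarrow> m < n"
    using assms unfolding admissible_order_def by blast+
  show "b \<in> boxes w" and bs: "set bs = boxes w - {b}"
    using set dist by auto
  show "\<forall>c\<in>boxes w. fst b \<le> fst c \<and> snd b \<le> snd c \<longrightarrow> c = b"
  proof (intro ballI impI, rule ccontr)
    fix c assume c: "c \<in> boxes w" "fst b \<le> fst c \<and> snd b \<le> snd c" and "c \<noteq> b"
    with bs have "c \<in> set bs" by simp
    then obtain n where n: "n < length bs" "bs ! n = c"
      by (auto simp: in_set_conv_nth)
    with order[of "length bs" n] c \<open>c \<noteq> b\<close> show False by (simp add: nth_append)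
  qed
  show "admissible_order w' bs" if "boxes w' = boxes w - {b}"
    unfolding admissible_order_def
  proof (intro conjI allI impI)
    fix m n
    assume "m < length bs" "n < length bs"
      "bs ! m \<noteq> bs ! n \<and> fst (bs ! m) \<le> fst (bs ! n) \<and> snd (bs ! m) \<le> snd (bs ! n)"
    then show "m < n" using order[of m n] by (simp add: nth_append)
  qed (use dist bs that in auto)
qed

text \<open>
  The exchange permutes the positions and keeps the order of all pairs except \<open>d u\<close>, which is not a
  pair constrained by \<open>small\<close>.
\<close>

lemma params_exchange:
  assumes len: "length zp = length p" "length zs = length s" and ud: "is_up u" "\<not> is_up d"
    and nonneg: "\<And>i. i < length (p @ [u, d] @ s) \<Longrightarrow> 0 \<le> (zp @ [x, y] @ zs) ! i"
    and small: "\<And>i j. i < j \<Longrightarrow> j < length (p @ [u, d] @ s) \<Longrightarrow>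
      ((p @ [u, d] @ s) ! i, (p @ [u, d] @ s) ! j) \<in> {(Prec, Succ), (Prec', Succ')} \<Longrightarrow>
      (zp @ [x, y] @ zs) ! i * (zp @ [x, y] @ zs) ! j < (1 :: real)"
  shows "i < length (p @ [d, u] @ s) \<Longrightarrow> 0 \<le> (zp @ [y, x] @ zs) ! i"
    "i < j \<Longrightarrow> j < length (p @ [d, u] @ s) \<Longrightarrow>
      ((p @ [d, u] @ s) ! i, (p @ [d, u] @ s) ! j) \<in> {(Prec, Succ), (Prec', Succ')} \<Longrightarrow>
      (zp @ [y, x] @ zs) ! i * (zp @ [y, x] @ zs) ! j < 1"
    "0 \<le> x" "0 \<le> y" "(u, d) \<in> {(Prec, Succ), (Prec', Succ')} \<Longrightarrow> x * y < 1"
proof -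
  let ?k = "length p"
  define f where "f i = (if i = ?k then Suc ?k else if i = Suc ?k then ?k else i)" for i
  have swap: "(as @ [b, a] @ cs) ! i = (as @ [a, b] @ cs) ! f i" if "length as = ?k"
    for as cs :: "'a list" and a b i
    using that by (auto simp: f_def nth_append nth_Cons')
  have w: "(p @ [d, u] @ s) ! t = (p @ [u, d] @ s) ! f t" for t by (rule swap) (rule refl)
  have z: "(zp @ [y, x] @ zs) ! t = (zp @ [x, y] @ zs) ! f t" for t by (rule swap) (rule len(1))
  have f_less: "f i < length (p @ [u, d] @ s)" if "i < length (p @ [d, u] @ s)" for i
    using that by (auto simp: f_def)
  show "0 \<le> (zp @ [y, x] @ zs) ! i" if "i < length (p @ [d, u] @ s)"
    unfolding z by (rule nonneg[OF f_less[OF that]])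
  show "(zp @ [y, x] @ zs) ! i * (zp @ [y, x] @ zs) ! j < 1"
    if "i < j" "j < length (p @ [d, u] @ s)"
      "((p @ [d, u] @ s) ! i, (p @ [d, u] @ s) ! j) \<in> {(Prec, Succ), (Prec', Succ')}"
  proof -
    \<comment> \<open>These two positions hold \<open>d u\<close> in the new word.\<close>
    have "i \<noteq> ?k \<or> j \<noteq> Suc ?k" using that(3) ud by auto
    then have "f i < f j" using that(1) by (auto simp: f_def)
    then show ?thesis
      using small[OF _ f_less[OF that(2)], of "f i"] that(3) unfolding w z by simp
  qed
  show "0 \<le> x" "0 \<le> y"
    using nonneg[of ?k] nonneg[of "Suc ?k"] len by (simp_all add: nth_append)
  show "x * y < 1" if "(u, d) \<in> {(Prec, Succ), (Prec', Succ')}"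
    using small[of ?k "Suc ?k"] len that by (simp add: nth_append)
qed

text \<open>
  The induction must treat all words and parameters simultaneously, since removing the last box
  changes both.
\<close>

lemma is_schur_process_along:
  assumes "length z = length w"
    and "\<And>i. i < length w \<Longrightarrow> 0 \<le> z ! i"
    and "\<And>i j. i < j \<Longrightarrow> j < length w \<Longrightarrow> (w ! i, w ! j) \<in> {(Prec, Succ), (Prec', Succ')}
           \<Longrightarrow> z ! i * z ! j < 1"
    and "admissible_order w bs"
  shows "is_schur_process w z (SchurSample_along bs w z)"
  using assms
proof (induction bs arbitrary: w z rule: rev_induct)
  case Nil
  then have "boxes w = {}" by (simp add: admissible_order_def)
  with Nil(1) show ?case by (rule is_schur_process_no_boxes[rotated])
next
  case (snoc b bs)
  note adm = admissible_order_snoc[OF snoc.prems(4)]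
  obtain p u d s where w: "w = p @ [u, d] @ s" and ud: "is_up u" "\<not> is_up d"
    and b: "b = (Suc (length (up_positions p)), Suc (length (down_positions s)))"
    by (rule corner_decomposition[OF adm(1,3)])
  define zp x y zs where "zp = take (length p) z" and "x = z ! length p"
    and "y = z ! Suc (length p)" and "zs = drop (Suc (Suc (length p))) z"
  have z: "z = zp @ [x, y] @ zs"
    using snoc.prems(1) id_take_nth_drop[of "length p" z]
      Cons_nth_drop_Suc[of "Suc (length p)" z, symmetric]
    unfolding zp_def x_def y_def zs_def by (simp add: w)
  have len: "length zp = length p" "length zs = length s"
    using snoc.prems(1) by (simp_all add: zp_def zs_def w)
  let ?w' = "p @ [d, u] @ s" and ?z' = "zp @ [y, x] @ zs"
  note exchanged = params_exchange[OF len ud snoc.prems(2,3)[unfolded w z]]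
  have "boxes ?w' = boxes w - {b}"
    using boxes_exchange[OF ud] by (simp only: w b)
  from adm(4)[OF this] have "is_schur_process ?w' ?z' (SchurSample_along bs ?w' ?z')"
    using exchanged(1,2) len by (intro snoc.IH) auto
  from is_schur_process_exchange[OF ud exchanged(3,4,5) len(1) this]
  show ?case
    unfolding w z using SchurSample_along_snoc[OF ud len _ b, of bs x y] adm(2)
    by (simp only: w) auto
qed

lemma sorted_wrt_rows:
  assumes "sorted_wrt (<) js"
  shows "sorted_wrt (\<lambda>b c. \<not> (fst c \<le> fst b \<and> snd c \<le> snd b))
    (concat (map (\<lambda>j. map (\<lambda>i. (i, j)) [1..<f j]) (js :: nat list)))"
  using assms
proof (induction js)
  case (Cons j js)
  have "sorted_wrt (\<lambda>b c. \<not> (fst c \<le> fst b \<and> snd c \<le> snd b)) (map (\<lambda>i. (i, j)) [1..<f j])"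
    by (auto simp: sorted_wrt_map intro: sorted_wrt_mono_rel[OF _ sorted_wrt_upt])
  with Cons show ?case by (fastforce simp: sorted_wrt_append)
qed simp

lemma admissible_double_loop:
  "admissible_order w [(i, j). j \<leftarrow> [1..<len_part (sh w) + 1], i \<leftarrow> [1..<sh w (j - 1) + 1]]"
proof -
  let ?R = "\<lambda>b c :: nat \<times> nat. \<not> (fst c \<le> fst b \<and> snd c \<le> snd b)"
  define bs where "bs = [(i, j). j \<leftarrow> [1..<len_part (sh w) + 1], i \<leftarrow> [1..<sh w (j - 1) + 1]]"
  have "sorted_wrt ?R bs"
    unfolding bs_def by (rule sorted_wrt_rows[of _ "\<lambda>j. sh w (j - 1) + 1"]) (rule sorted_wrt_upt)
  then have R: "?R (bs ! p) (bs ! q)" if "p < q" "q < length bs" for p q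
    using that by (rule sorted_wrt_nth_less)
  have "distinct bs"
    unfolding distinct_conv_nth using R by (metis linorder_neqE_nat order.refl)
  moreover have "set bs = (\<Union>j\<in>{1..<len_part (sh w) + 1}. (\<lambda>i. (i, j)) ` {1..<sh w (j - 1) + 1})"
    unfolding bs_def by (simp only: set_concat set_map set_upt image_image)
  then have "set bs = boxes w"
    unfolding boxes_def by (force simp: less_Suc_eq_le)
  moreover have "p < q" if "p < length bs" "q < length bs"
    "bs ! p \<noteq> bs ! q" "fst (bs ! p) \<le> fst (bs ! q)" "snd (bs ! p) \<le> snd (bs ! q)" for p q
    using R[of q p] that by (metis linorder_neqE_nat)
  ultimately have "admissible_order w bs" unfolding admissible_order_def by blast
  then show ?thesis unfolding bs_def .
qed

theorem theorem3p2:
  fixes w :: "letter list" and z :: "real list"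
  assumes "length z = length w"
    and "\<And>i. i < length w \<Longrightarrow> 0 \<le> z ! i"
    and "\<And>i j. i < j \<Longrightarrow> j < length w \<Longrightarrow> (w ! i, w ! j) \<in> {(Prec, Succ), (Prec', Succ')}
           \<Longrightarrow> z ! i * z ! j < 1"
  shows "is_schur_process w z (SchurSample w z) \<and>
         (\<forall>bs. admissible_order w bs \<longrightarrow> is_schur_process w z (SchurSample_along bs w z))"
proof -
  have "is_schur_process w z (SchurSample_along bs w z)" if "admissible_order w bs" for bs
    using assms that by (rule is_schur_process_along)
  with admissible_double_loop show ?thesis unfolding SchurSample_def by blast
qed

end
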